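(* Let $W$ be a graphon, let $N\ge 1$ be an integer and let $\nu\in(0,1)$. Let $G_N$ and $\bar G_N$ be the graphs sampled from $W$ with stochastic latent variables $X_1,\dots,X_N$, with normalized degrees $\delta_{(i)}$, $\bar\delta_{(i)}$ and normalized Laplacian-matrix eigenvalues $\mu_i$, $\bar\mu_i$ respectively (all listed in non-decreasing order). Then, with probability at least $1-\nu$, $$\max_{i=1,\dots,N}\left|\delta_{(i)}-\bar\delta_{(i)}\right|\le \sqrt{\frac{\log(2N/\nu)}{N}}.$$ Moreover, if $\bar d_{(N)}>\frac{4}{9}\log(2N/\nu)$, then with probability at least $1-2\nu$ $$\max_{i=1,\dots,N}\left|\mu_i-\bar\mu_i\right|\le 3\sqrt{\frac{\log(2N/\nu)}{N}};$$ that is, the conditional probability of this last inequality given the event $\{\bar d_{(N)}>\frac{4}{9}\log(2N/\nu)\}$ (whenever this event has positive probability) is at least $1-2\nu$.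
   Context: A graphon is a symmetric measurable function $W:[0,1]^2\to[0,1]$. Stochastic sampling: let $U_1,\dots,U_N$ be i.i.d. uniform random variables on $[0,1]$ and let the latent variables $X_1\le\dots\le X_N$ be their reordering in increasing order. The weighted graph $\bar G_N$ has vertex set $\{1,\dots,N\}$ and adjacency matrix $[\bar A_N]_{ij}=W(X_i,X_j)$ for all $i,j$. The random graph $G_N$ has symmetric $\{0,1\}$-valued adjacency matrix $A_N$ whose entries $[A_N]_{ij}$, $i\le j$, are, conditionally on $X_1,\dots,X_N$, independent Bernoulli random variables with mean $W(X_i,X_j)$; thus $\mathrm{E}[A_N\mid X_1,\dots,X_N]=\bar A_N$. The degrees are the row sums $d_i=\sum_{j=1}^N[A_N]_{ij}$ and $\bar d_i=\sum_{j=1}^N W(X_i,X_j)$. $D_N$ and $\bar D_N$ are the diagonal matrices of degrees, and the Laplacian matrices are $L_N=D_N-A_N$ and $\bar L_N=\bar D_N-\bar A_N$. $d_{(1)}\le\dots\le d_{(N)}$ and $\bar d_{(1)}\le\dots\le\bar d_{(N)}$ denote the degrees sorted in non-decreasing order (so $\bar d_{(N)}$ is the maximum degree of $\bar G_N$), and the normalized degrees are $\delta_{(i)}=d_{(i)}/N$, $\bar\delta_{(i)}=\bar d_{(i)}/N$. The normalized eigenvalues $\mu_1\le\dots\le\mu_N$ (resp. $\bar\mu_1\le\dots\le\bar\mu_N$) are the eigenvalues of $L_N$ (resp. $\bar L_N$) divided by $N$, in non-decreasing order. $\log$ is the natural logarithm. *)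

theory Defs
  imports
    "HOL-Probability.Probability"
    "Jordan_Normal_Form.Char_Poly"
begin

(* Vertices, and hence matrix and list positions, are numbered 0, ..., N - 1. *)

(* "Measurable" means Borel measurable: the diagonal values W (x, x) are sampled as well, and
   for a merely Lebesgue measurable W these need not form a measurable function of x. *)
definition graphon :: "(real \<Rightarrow> real \<Rightarrow> real) \<Rightarrow> bool" where
  "graphon W \<longleftrightarrow>
     case_prod W \<in> borel_measurable (restrict_space borel ({0..1} \<times> {0..1})) \<and>
     (\<forall>x\<in>{0..1}. \<forall>y\<in>{0..1}. W x y \<in> {0..1} \<and> W x y = W y x)"

(* The condition that all values lie in [0,1] makes the U i random variables with values in
   [0,1], and not only almost surely so; W is unspecified outside the unit square. *)
definition iid_uniform :: "'a measure \<Rightarrow> nat \<Rightarrow> (nat \<Rightarrow> 'a \<Rightarrow> real) \<Rightarrow> bool" where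
  "iid_uniform M N U \<longleftrightarrow>
     prob_space.indep_vars M (\<lambda>_. borel) U {..<N} \<and>
     (\<forall>i<N. (\<forall>\<omega>\<in>space M. U i \<omega> \<in> {0..1}) \<and>
            distr M lborel (U i) = uniform_measure lborel {0..1})"

definition latent :: "nat \<Rightarrow> (nat \<Rightarrow> 'a \<Rightarrow> real) \<Rightarrow> nat \<Rightarrow> 'a \<Rightarrow> real" where
  "latent N U i \<omega> = sort (map (\<lambda>j. U j \<omega>) [0..<N]) ! i"

(* The sigma-algebra generated by X 0, ..., X (N - 1). *)
definition generated_algebra :: "'a measure \<Rightarrow> nat \<Rightarrow> (nat \<Rightarrow> 'a \<Rightarrow> real) \<Rightarrow> 'a measure" where
  "generated_algebra M N X =
     vimage_algebra (space M) (\<lambda>\<omega>. \<lambda>i\<in>{..<N}. X i \<omega>) (\<Pi>\<^sub>M i\<in>{..<N}. borel)"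

definition cond_indep_vars ::
    "'a measure \<Rightarrow> 'a measure \<Rightarrow> ('i \<Rightarrow> 'a \<Rightarrow> real) \<Rightarrow> 'i set \<Rightarrow> bool" where
  "cond_indep_vars M F Y I \<longleftrightarrow>
     (\<forall>k\<in>I. Y k \<in> borel_measurable M) \<and>
     (\<forall>J B. J \<subseteq> I \<longrightarrow> finite J \<longrightarrow> (\<forall>k\<in>J. B k \<in> sets borel) \<longrightarrow>
       (AE \<omega> in M.
          real_cond_exp M F (indicator {\<omega>\<in>space M. \<forall>k\<in>J. Y k \<omega> \<in> B k}) \<omega> =
          (\<Prod>k\<in>J. real_cond_exp M F (indicator {\<omega>\<in>space M. Y k \<omega> \<in> B k}) \<omega>)))"

definition cond_bernoulli ::
    "'a measure \<Rightarrow> 'a measure \<Rightarrow> ('a \<Rightarrow> real) \<Rightarrow> ('a \<Rightarrow> real) \<Rightarrow> bool" where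
  "cond_bernoulli M F Y p \<longleftrightarrow>
     Y \<in> borel_measurable M \<and> (\<forall>\<omega>\<in>space M. Y \<omega> \<in> {0, 1}) \<and>
     (AE \<omega> in M. real_cond_exp M F Y \<omega> = p \<omega>)"

definition weighted_adjacency ::
    "(real \<Rightarrow> real \<Rightarrow> real) \<Rightarrow> nat \<Rightarrow> (nat \<Rightarrow> 'a \<Rightarrow> real) \<Rightarrow> 'a \<Rightarrow> real mat" where
  "weighted_adjacency W N X \<omega> = Matrix.mat N N (\<lambda>(i, j). W (X i \<omega>) (X j \<omega>))"

definition random_adjacency ::
    "'a measure \<Rightarrow> (real \<Rightarrow> real \<Rightarrow> real) \<Rightarrow> nat \<Rightarrow> (nat \<Rightarrow> 'a \<Rightarrow> real) \<Rightarrow> ('a \<Rightarrow> real mat) \<Rightarrow> bool"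
  where
  "random_adjacency M W N X A \<longleftrightarrow>
     (\<forall>\<omega>\<in>space M. A \<omega> \<in> carrier_mat N N \<and> transpose_mat (A \<omega>) = A \<omega>) \<and>
     cond_indep_vars M (generated_algebra M N X)
       (\<lambda>(i, j) \<omega>. A \<omega> $$ (i, j)) {(i, j). i \<le> j \<and> j < N} \<and>
     (\<forall>i j. i \<le> j \<and> j < N \<longrightarrow>
        cond_bernoulli M (generated_algebra M N X)
          (\<lambda>\<omega>. A \<omega> $$ (i, j)) (\<lambda>\<omega>. W (X i \<omega>) (X j \<omega>)))"

definition degree_of :: "real mat \<Rightarrow> nat \<Rightarrow> real" where
  "degree_of A i = (\<Sum>j<dim_col A. A $$ (i, j))"

definition sorted_degrees :: "real mat \<Rightarrow> real list" where
  "sorted_degrees A = sort (map (degree_of A) [0..<dim_row A])"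

definition laplacian :: "real mat \<Rightarrow> real mat" where
  "laplacian A = mat_diag (dim_row A) (degree_of A) - A"

(* Eigenvalues with algebraic multiplicity. Only real ones are listed, which for symmetric
   matrices are all of them. *)
definition sorted_eigenvalues :: "real mat \<Rightarrow> real list" where
  "sorted_eigenvalues A = sorted_list_of_multiset (proots (char_poly A))"

definition normalized_degree :: "real mat \<Rightarrow> nat \<Rightarrow> real" where
  "normalized_degree A i = sorted_degrees A ! i / real (dim_row A)"

definition normalized_laplacian_eigenvalue :: "real mat \<Rightarrow> nat \<Rightarrow> real" where
  "normalized_laplacian_eigenvalue A i = sorted_eigenvalues (laplacian A) ! i / real (dim_row A)"

end

theory Submission
  imports Defs "Jordan_Normal_Form.Schur_Decomposition"
begin

text \<open>
  Write \<open>L\<close> for \<open>ln (2 N / \<nu>)\<close>. Conditionally on the latent variables, every linear form in the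
  entries of \<open>A - Abar\<close> satisfies Hoeffding's inequality. Applied to the \<open>N\<close> row sums this bounds all
  degree deviations by \<open>sqrt (N L)\<close>, and sorting is 1-Lipschitz in the maximum norm.

  By Weyl's inequality the Laplacian eigenvalues move by at most the norm of the difference of the
  Laplacians, that is, by the largest degree deviation plus the norm of \<open>A - Abar\<close>. Instead of a matrix
  Chernoff bound, the latter norm is bounded by \<open>2 sqrt (N L)\<close> with a net argument: for a fixed vector
  \<open>y\<close>, the quadratic form exceeds \<open>3 / 2 sqrt (N L) (y \<bullet> y)\<close> with conditional probability at most
  \<open>2 exp (- 9 / 4 N L)\<close>. The factor \<open>N ln N\<close> in this exponent is large enough to pay for a naive cubic
  grid of \<open>(4 N + 1) ^ N\<close> points. All bounds hold on each event that is determined by the latent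
  variables, which gives the conditional probability.
\<close>

subsection \<open>Spectral theorem for real symmetric matrices\<close>

text \<open>Conditional independence is given only as an almost sure identity between conditional
  expectations of indicators. So the Hoeffding bound is not proved at a fixed outcome: the space is
  cut into the finitely many 0/1 patterns of the upper triangle, on each of which the random
  exponential is a function of the latent variables alone and can be pulled out. Integrating over
  \<open>E\<close> then produces bounds with a factor \<open>prob E\<close>.

  The entries (i, j) and (j, i) are one variable, so a linear form is folded onto the upper
  triangle, which at most doubles the sum of squared coefficients; hence the exponent
  \<open>- t\<^sup>2 / V\<close> instead of \<open>- 2 * t\<^sup>2 / V\<close>. The constant 3 is 1
  for the degrees plus 2 for the adjacency matrices. Passing to the grid costs a factor 3/4, which
  leaves 3/2, and what matters is that (3/2)^2 exceeds 2: up to a factor 2, a grid point fails with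
  probability at most (\<nu> / (2 N))^(2 N).\<close>

lemma symmetric_complex_eigenvalue_real:
  fixes A :: "real mat"
  assumes A: "A \<in> carrier_mat n n" and sym: "transpose_mat A = A"
    and ev: "eigenvalue (map_mat complex_of_real A) a"
  shows "a \<in> \<real>"
proof -
  let ?A = "map_mat complex_of_real A"
  have A': "?A \<in> carrier_mat n n" using A by simp
  from ev A obtain v where v: "v \<in> carrier_vec n" "v \<noteq> 0\<^sub>v n" and eig: "?A *\<^sub>v v = a \<cdot>\<^sub>v v"
    unfolding eigenvalue_def eigenvector_def by auto
  have symA: "A $$ (i, j) = A $$ (j, i)" if "i < n" "j < n" for i j
    by (metis A carrier_matD index_transpose_mat(1) sym that)
  have row: "(\<Sum>j<n. of_real (A $$ (i, j)) * v $ j) = a * v $ i" if "i < n" for i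
  proof -
    have "(?A *\<^sub>v v) $ i = (\<Sum>j<n. of_real (A $$ (i, j)) * v $ j)"
      using A v that by (simp add: scalar_prod_def lessThan_atLeast0)
    thus ?thesis using eig v that by simp
  qed
  define R where "R = (\<Sum>i<n. (cmod (v $ i))\<^sup>2)"
  \<comment> \<open>\<open>S\<close> is the Hermitian form at v. Conjugation exchanges its two
    indices and so fixes it, as the matrix is real and symmetric; it is also a times the positive
    real \<open>R\<close>.\<close>
  define S where "S = (\<Sum>i<n. \<Sum>j<n. cnj (v $ i) * (of_real (A $$ (i, j)) * v $ j))"
  have "S = (\<Sum>i<n. cnj (v $ i) * (\<Sum>j<n. of_real (A $$ (i, j)) * v $ j))"
    by (simp add: S_def sum_distrib_left)
  also have "\<dots> = (\<Sum>i<n. a * of_real ((cmod (v $ i))\<^sup>2))"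
  proof (rule sum.cong)
    fix i assume "i \<in> {..<n}"
    thus "cnj (v $ i) * (\<Sum>j<n. of_real (A $$ (i, j)) * v $ j)
        = a * of_real ((cmod (v $ i))\<^sup>2)"
      using row[of i] by (simp only: lessThan_iff complex_norm_square) (simp only: mult_ac)
  qed simp
  also have "\<dots> = a * of_real R"
    by (simp add: R_def sum_distrib_left)
  finally have S: "S = a * of_real R" .
  have "cnj S = (\<Sum>i<n. \<Sum>j<n. cnj (v $ j) * (of_real (A $$ (i, j)) * v $ i))"
    by (simp add: S_def mult_ac)
  also have "\<dots> = (\<Sum>j<n. \<Sum>i<n. cnj (v $ j) * (of_real (A $$ (i, j)) * v $ i))"
    by (rule sum.swap)
  also have "\<dots> = S"
    unfolding S_def by (intro sum.cong refl) (simp add: symA)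
  finally have "S \<in> \<real>" by (simp add: Reals_cnj_iff)
  from v obtain i where "i < n" "v $ i \<noteq> 0"
    by (metis carrier_vecD eq_vecI index_zero_vec(1) index_zero_vec(2))
  hence "R > 0"
    unfolding R_def by (intro sum_pos2[of _ i]) auto
  hence "a = S / of_real R" using S by simp
  with \<open>S \<in> \<real>\<close> show ?thesis by simp
qed

text \<open>Over the complex numbers the polynomial splits, with real roots only. Replacing each
  root by its real part gives a real product with the same image, and the embedding of polynomials
  is injective.\<close>

lemma symmetric_char_poly_splits:
  fixes A :: "real mat"
  assumes A: "A \<in> carrier_mat n n" and sym: "transpose_mat A = A"
  obtains es where "char_poly A = (\<Prod>e\<leftarrow>es. [:- e, 1:])"
proof -
  interpret cpoly: map_poly_inj_idom_hom complex_of_real ..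
  let ?A = "map_mat complex_of_real A"
  have A': "?A \<in> carrier_mat n n" using A by simp
  from char_poly_factorized[OF A'] obtain as
    where as: "char_poly ?A = (\<Prod>a\<leftarrow>as. [:- a, 1:])" by blast
  have re: "of_real (Re a) = a" if "a \<in> set as" for a
  proof -
    have "poly (char_poly ?A) a = 0"
      unfolding as poly_prod_list using that by (auto simp: prod_list_zero_iff o_def)
    hence "eigenvalue ?A a" using eigenvalue_root_char_poly[OF A'] by simp
    from symmetric_complex_eigenvalue_real[OF A sym this] show ?thesis
      by simp
  qed
  have "map_poly complex_of_real (char_poly A) = char_poly ?A"
    by (simp only: of_real_hom.char_poly_hom[OF A])
  also have "\<dots> = (\<Prod>a\<leftarrow>as. map_poly complex_of_real [:- Re a, 1:])"
    unfolding as by (intro arg_cong[of _ _ prod_list] map_cong refl) (simp add: re)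
  also have "\<dots> = map_poly complex_of_real (\<Prod>e\<leftarrow>map Re as. [:- e, 1:])"
    by (simp add: cpoly.hom_prod_list o_def)
  finally have "char_poly A = (\<Prod>e\<leftarrow>map Re as. [:- e, 1:])"
    by (metis cpoly.eq_iff) 
  thus ?thesis by (rule that)
qed

text \<open>\<open>sorted_eigenvalues\<close> collects real roots only. The splitting guarantees
  that none is missing, so that all positions below n are in range.\<close>

lemma sorted_eigenvalues_char_poly:
  fixes A :: "real mat"
  assumes A: "A \<in> carrier_mat n n" and sym: "transpose_mat A = A"
  shows "char_poly A = (\<Prod>e\<leftarrow>sorted_eigenvalues A. [:- e, 1:])"
    and "length (sorted_eigenvalues A) = n"
    and "sorted (sorted_eigenvalues A)"
proof -
  from symmetric_char_poly_splits[OF A sym] obtain es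
    where es: "char_poly A = (\<Prod>e\<leftarrow>es. [:- e, 1:])" .
  have "proots (\<Prod>e\<leftarrow>fs. [:- e, 1:]) = mset fs" for fs :: "real list"
  proof (induction fs)
    case (Cons e fs)
    have "(\<Prod>e\<leftarrow>fs. [:- e, 1:]) \<noteq> 0" by (auto simp: prod_list_zero_iff)
    thus ?case using Cons by (simp add: proots_mult del: mult_pCons_left)
  qed simp
  hence "proots (char_poly A) = mset es" using es by simp
  hence mset: "mset (sorted_eigenvalues A) = mset es"
    unfolding sorted_eigenvalues_def by simp
  have "char_poly A = prod_mset (image_mset (\<lambda>e. [:- e, 1:]) (mset es))"
    unfolding es by (metis mset_map prod_mset_prod_list)
  thus cp: "char_poly A = (\<Prod>e\<leftarrow>sorted_eigenvalues A. [:- e, 1:])"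
    unfolding mset[symmetric] by (metis mset_map prod_mset_prod_list)
  show "length (sorted_eigenvalues A) = n"
    using degree_linear_factors[of uminus "sorted_eigenvalues A"] degree_monic_char_poly[OF A]
    unfolding cp[symmetric] by simp
  show "sorted (sorted_eigenvalues A)"
    unfolding sorted_eigenvalues_def by simp
qed


section \<open>Orthogonal diagonalization\<close>

definition orthogonal_mat :: "nat \<Rightarrow> real mat \<Rightarrow> bool" where
  "orthogonal_mat n P \<longleftrightarrow>
     P \<in> carrier_mat n n \<and> transpose_mat P * P = 1\<^sub>m n \<and> P * transpose_mat P = 1\<^sub>m n"

lemma orthogonal_matI:
  assumes "P \<in> carrier_mat n n" "transpose_mat P * P = 1\<^sub>m n"
  shows "orthogonal_mat n P"
  using assms mat_mult_left_right_inverse[of "transpose_mat P" n P]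
  unfolding orthogonal_mat_def by auto

lemma orthogonal_mat_mult:
  assumes "orthogonal_mat n P" "orthogonal_mat n Q"
  shows "orthogonal_mat n (P * Q)"
proof (rule orthogonal_matI)
  have P: "P \<in> carrier_mat n n" "transpose_mat P \<in> carrier_mat n n" "transpose_mat P * P = 1\<^sub>m n"
    and Q: "Q \<in> carrier_mat n n" "transpose_mat Q \<in> carrier_mat n n" "transpose_mat Q * Q = 1\<^sub>m n"
    using assms unfolding orthogonal_mat_def by auto
  show "P * Q \<in> carrier_mat n n" using P Q by simp
  have "transpose_mat P * (P * Q) = transpose_mat P * P * Q"
    by (rule assoc_mult_mat[symmetric]) (use P Q in auto)
  also have "\<dots> = Q" unfolding P(3) using Q by simp
  finally have "transpose_mat P * (P * Q) = Q" .
  thus "transpose_mat (P * Q) * (P * Q) = 1\<^sub>m n"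
    using P Q by (simp add: transpose_mult[of _ n n] assoc_mult_mat[of _ n n _ n _ n])
qed

text \<open>Gram-Schmidt on a basis that starts with v keeps v as its first vector; the
  normalization then rescales it, whence the unspecified factor c.\<close>

lemma orthogonal_mat_with_first_col:
  fixes v :: "real vec"
  assumes v: "v \<in> carrier_vec n" and v0: "v \<noteq> 0\<^sub>v n" and n: "n \<noteq> 0"
  obtains P c where "orthogonal_mat n P" "col P 0 = c \<cdot>\<^sub>v v"
proof -
  interpret cof_vec_space n "TYPE(real)" .
  define b where "b = basis_completion v"
  define ws where "ws = gram_schmidt n b"
  from basis_completion[OF v v0, folded b_def]
  have b: "distinct b" "\<not> lin_dep (set b)" "set b \<subseteq> carrier_vec n" "hd b = v" "length b = n"
    by auto
  then obtain vs where bv: "b = v # vs" using n by (cases b) auto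
  from gram_schmidt_result[OF b(3,1,2) refl, folded ws_def] b
  have ws: "set ws \<subseteq> carrier_vec n" "corthogonal ws" "length ws = n" by auto
  from gram_schmidt_hd[OF v, of vs, folded bv] have hd: "hd ws = v" unfolding ws_def .
  define s where "s i = 1 / sqrt (ws ! i \<bullet> ws ! i)" for i
  define P where "P = mat_of_cols n (map (\<lambda>i. s i \<cdot>\<^sub>v ws ! i) [0..<n])"
  have P: "P \<in> carrier_mat n n" unfolding P_def by (rule carrier_matI) auto
  have wsc: "ws ! i \<in> carrier_vec n" if "i < n" for i using ws that by auto
  have col: "col P i = s i \<cdot>\<^sub>v ws ! i" if "i < n" for i
    using that wsc[OF that] unfolding P_def by (subst col_mat_of_cols) auto
  \<comment> \<open>\<open>corthogonal\<close> uses the conjugated inner product, which over the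
    reals is the plain one.\<close>
  have conj: "conjugate w = w" for w :: "real vec" by (intro eq_vecI) auto
  have orth: "ws ! i \<bullet> ws ! j = 0 \<longleftrightarrow> i \<noteq> j" if "i < n" "j < n" for i j
    using corthogonalD[OF ws(2), of i j] that ws(3) by (simp add: conj)
  have "transpose_mat P * P = 1\<^sub>m n"
  proof (rule eq_matI)
    fix i j assume ij: "i < dim_row (1\<^sub>m n :: real mat)" "j < dim_col (1\<^sub>m n :: real mat)"
    have "(transpose_mat P * P) $$ (i, j) = col P i \<bullet> col P j" using P ij by simp
    also have "\<dots> = s i * s j * (ws ! i \<bullet> ws ! j)" using ij wsc[of i] wsc[of j] by (simp add: col smult_scalar_prod_distrib[of _ n] scalar_prod_smult_distrib[of _ n])
    also have "\<dots> = (if i = j then 1 else 0)"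
    proof (cases "i = j")
      case True
      have "ws ! i \<bullet> ws ! i > 0"
        using orth[of i i] ij by (simp add: scalar_prod_def sum_nonneg less_le)
      thus ?thesis using True by (simp add: s_def)
    next
      case False
      thus ?thesis using orth[of i j] ij by simp
    qed
    finally show "(transpose_mat P * P) $$ (i, j) = 1\<^sub>m n $$ (i, j)" using ij by simp
  qed (use P in auto)
  with P have "orthogonal_mat n P" by (rule orthogonal_matI)
  moreover have "ws ! 0 = v" using hd ws n by (metis hd_conv_nth length_0_conv)
  hence "col P 0 = s 0 \<cdot>\<^sub>v v" using col[of 0] n by simp
  ultimately show ?thesis by (rule that)
qed

lemma mult_block_diag:
  assumes "A \<in> carrier_mat n n" "B \<in> carrier_mat m m" "C \<in> carrier_mat n n" "D \<in> carrier_mat m m"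
  shows "four_block_mat A (0\<^sub>m n m) (0\<^sub>m m n) B * four_block_mat C (0\<^sub>m n m) (0\<^sub>m m n) D
    = four_block_mat (A * C) (0\<^sub>m n m) (0\<^sub>m m n) (B * D)"
  using assms by (subst mult_four_block_mat[of _ n n _ m _ m _ _ n _ m]) auto

text \<open>Deflation along the list of roots: in an orthonormal basis that starts with an
  eigenvector, symmetry splits off a 1 x 1 block, and the other block has the remaining roots. The
  diagonal follows the order of the given list, so the sorted list may be inserted later.\<close>

theorem spectral_theorem:
  fixes A :: "real mat"
  assumes "A \<in> carrier_mat n n" "transpose_mat A = A" "char_poly A = (\<Prod>e\<leftarrow>es. [:- e, 1:])"
  shows "\<exists>P. orthogonal_mat n P \<and> transpose_mat P * A * P = mat_diag n (\<lambda>i. es ! i)"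
  using assms
proof (induction es arbitrary: n A)
  case Nil
  with degree_monic_char_poly[of A n] have n: "n = 0" by auto
  show ?case
    by (rule exI[of _ "1\<^sub>m n"]) (use n Nil in \<open>auto simp: orthogonal_mat_def mat_diag_def intro!: eq_matI\<close>)
next
  case (Cons e es)
  note A = Cons.prems(1) and sym = Cons.prems(2)
  have cp: "char_poly A = [:- e, 1:] * (\<Prod>e\<leftarrow>es. [:- e, 1:])" using Cons.prems(3) by simp
  have "monic (\<Prod>e\<leftarrow>es. [:- e, 1:])" by (rule monic_prod_list) auto
  hence "degree (char_poly A) = Suc (degree (\<Prod>e\<leftarrow>es. [:- e, 1:]))"
    unfolding cp by (subst degree_mult_eq) auto
  with degree_monic_char_poly[OF A] obtain m where n: "n = Suc m" by (cases n) auto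
  have "eigenvalue A e" unfolding eigenvalue_root_char_poly[OF A] cp by simp
  then obtain v where v: "v \<in> carrier_vec n" "v \<noteq> 0\<^sub>v n" and Av: "A *\<^sub>v v = e \<cdot>\<^sub>v v"
    using A unfolding eigenvalue_def eigenvector_def by auto
  from orthogonal_mat_with_first_col[OF v] n obtain W c
    where W: "orthogonal_mat n W" and colW: "col W 0 = c \<cdot>\<^sub>v v" by auto
  let ?T = transpose_mat
  have Wc: "W \<in> carrier_mat n n" and TW: "?T W \<in> carrier_mat n n" and TWW: "?T W * W = 1\<^sub>m n"
    and WTW: "W * ?T W = 1\<^sub>m n"
    using W unfolding orthogonal_mat_def by auto
  define B where "B = ?T W * A * W"
  have B: "B \<in> carrier_mat n n" unfolding B_def using Wc A by simp
  have "?T B = ?T W * ?T (?T W * A)"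
    unfolding B_def by (rule transpose_mult) (use Wc TW A in auto)
  also have "?T (?T W * A) = A * W" using transpose_mult[OF TW A] sym by simp
  also have "?T W * (A * W) = B"
    unfolding B_def by (rule assoc_mult_mat[symmetric]) (use Wc TW A in auto)
  finally have symB: "?T B = B" .
  have "similar_mat_wit B A (?T W) W"
    by (rule similar_mat_witI[of _ _ n]) (use Wc A B TWW WTW in \<open>auto simp: B_def\<close>)
  hence cpB: "char_poly B = char_poly A"
    using char_poly_similar unfolding similar_mat_def by blast
  have "A *\<^sub>v col W 0 = e \<cdot>\<^sub>v col W 0"
    unfolding colW using A v Av by (simp add: mult_mat_vec smult_smult_assoc mult.commute)
  moreover have "col (A * W) 0 = A *\<^sub>v col W 0"
    using A Wc n by (intro eq_vecI) auto
  ultimately have colAW: "col (A * W) 0 = e \<cdot>\<^sub>v col W 0" by simp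
  \<comment> \<open>The first column of A W is e times that of W, so the first column of
    \<open>B\<close> is e times that of the identity. Symmetry will give the first row.\<close>
  have B0: "B $$ (i, 0) = (if i = 0 then e else 0)" if i: "i < n" for i
  proof -
    have "B $$ (i, 0) = (?T W * (A * W)) $$ (i, 0)"
      unfolding B_def using TW A Wc by (simp add: assoc_mult_mat[of _ n n _ n _ n])
    also have "\<dots> = row (?T W) i \<bullet> (e \<cdot>\<^sub>v col W 0)"
      using i n A Wc TW by (simp add: colAW[symmetric])
    also have "\<dots> = e * (?T W * W) $$ (i, 0)" using i n Wc TW by simp
    finally show ?thesis using i n by (simp add: TWW)
  qed
  define D where "D = mat m m (\<lambda>(i, j). B $$ (Suc i, Suc j))"
  have D: "D \<in> carrier_mat m m" unfolding D_def by simp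
  have B_sym: "B $$ (i, j) = B $$ (j, i)" if "i < n" "j < n" for i j
    by (metis B carrier_matD index_transpose_mat(1) symB that)
  have symD: "?T D = D" using B_sym n by (intro eq_matI) (auto simp: D_def)
  let ?E = "mat 1 1 (\<lambda>_. e)"
  have B_block: "B = four_block_mat ?E (0\<^sub>m 1 m) (0\<^sub>m m 1) D"
  proof (rule eq_matI)
    fix i j assume "i < dim_row (four_block_mat ?E (0\<^sub>m 1 m) (0\<^sub>m m 1) D)"
      "j < dim_col (four_block_mat ?E (0\<^sub>m 1 m) (0\<^sub>m m 1) D)"
    hence "i < n" "j < n" using n D by auto
    thus "B $$ (i, j) = four_block_mat ?E (0\<^sub>m 1 m) (0\<^sub>m m 1) D $$ (i, j)"
      using n D B0[of i] B0[of j] B_sym[of 0 j] by (cases i; cases j) (auto simp: D_def)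
  qed (use B D n in auto)
  have "char_poly B = char_poly ?E * char_poly D"
    unfolding B_block by (rule char_poly_four_block_zeros_col[OF _ _ D]) auto
  also have "char_poly ?E = [:- e, 1:]"
    by (simp add: char_poly_defs det_def sign_def)
  finally have "char_poly D = (\<Prod>e\<leftarrow>es. [:- e, 1:])"
    unfolding cpB cp by (metis mult_cancel_left pCons_eq_0_iff zero_neq_one)
  from Cons.IH[OF D symD this] obtain P
    where P: "orthogonal_mat m P" and PDP: "?T P * D * P = mat_diag m (\<lambda>i. es ! i)" by blast
  have Pc: "P \<in> carrier_mat m m" and TP: "?T P \<in> carrier_mat m m" and TPP: "?T P * P = 1\<^sub>m m"
    using P unfolding orthogonal_mat_def by auto
  \<comment> \<open>The diagonalization of the smaller block, extended by 1 in the corner that is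
    already diagonal.\<close>
  define Q where "Q = four_block_mat (1\<^sub>m 1) (0\<^sub>m 1 m) (0\<^sub>m m 1) P"
  have Qc: "Q \<in> carrier_mat n n" unfolding Q_def n using Pc by auto
  have TQ: "?T Q = four_block_mat (1\<^sub>m 1) (0\<^sub>m 1 m) (0\<^sub>m m 1) (?T P)"
    unfolding Q_def by (subst transpose_four_block_mat[of _ 1 1 _ m _ m]) (use Pc in auto)
  have TQc: "?T Q \<in> carrier_mat n n" using Qc by simp
  have "?T Q * Q = four_block_mat (1\<^sub>m 1) (0\<^sub>m 1 m) (0\<^sub>m m 1) (?T P * P)"
    unfolding TQ unfolding Q_def
    using Pc TP by (simp add: mult_block_diag[of _ "Suc 0" _ m])
  also have "\<dots> = 1\<^sub>m n" unfolding TPP n by simp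
  finally have Q: "orthogonal_mat n Q" using Qc by (intro orthogonal_matI)
  have "?T Q * B * Q = four_block_mat ?E (0\<^sub>m 1 m) (0\<^sub>m m 1) (?T P * D * P)"
    unfolding TQ B_block unfolding Q_def
    using Pc TP D by (simp add: mult_block_diag[of _ "Suc 0" _ m])
  also have "\<dots> = mat_diag n (\<lambda>i. (e # es) ! i)"
    unfolding PDP n by (intro eq_matI) (auto simp: mat_diag_def nth_Cons')
  finally have QBQ: "?T Q * B * Q = mat_diag n (\<lambda>i. (e # es) ! i)" .
  have "?T (W * Q) * A * (W * Q) = ?T Q * B * Q"
    unfolding B_def using Wc Qc A TW TQc
    by (simp add: transpose_mult[of _ n n] assoc_mult_mat[of _ n n _ n _ n])
  with QBQ orthogonal_mat_mult[OF W Q] show ?case by auto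
qed

subsection \<open>Perturbation of eigenvalues\<close>

lemma orthogonal_diagonal_quadratic_form:
  assumes P: "orthogonal_mat n P" and A: "A \<in> carrier_mat n n"
    and D: "transpose_mat P * A * P = mat_diag n d" and x: "x \<in> carrier_vec n"
  shows "x \<bullet> (A *\<^sub>v x) = (\<Sum>k<n. d k * ((transpose_mat P *\<^sub>v x) $ k)\<^sup>2)"
    and "x \<bullet> x = (\<Sum>k<n. ((transpose_mat P *\<^sub>v x) $ k)\<^sup>2)"
proof -
  define y where "y = transpose_mat P *\<^sub>v x"
  have Pc: "P \<in> carrier_mat n n" and TP: "transpose_mat P \<in> carrier_mat n n"
    and TPP: "transpose_mat P * P = 1\<^sub>m n" and PTP: "P * transpose_mat P = 1\<^sub>m n"
    using P unfolding orthogonal_mat_def by auto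
  have y: "y \<in> carrier_vec n" unfolding y_def using TP x by simp
  have xy: "x = P *\<^sub>v y"
    unfolding y_def using assoc_mult_mat_vec[OF Pc TP x] PTP x by simp
  have tr: "(P *\<^sub>v y) \<bullet> w = y \<bullet> (transpose_mat P *\<^sub>v w)" if "w \<in> carrier_vec n" for w
    using transpose_vec_mult_scalar[OF Pc y that] that Pc y
    by (metis TP comm_scalar_prod mult_mat_vec_carrier)
  have "x \<bullet> (A *\<^sub>v x) = y \<bullet> (transpose_mat P *\<^sub>v (A *\<^sub>v (P *\<^sub>v y)))"
    unfolding xy by (rule tr) (use A Pc y in simp)
  also have "transpose_mat P *\<^sub>v (A *\<^sub>v (P *\<^sub>v y)) = (transpose_mat P * A * P) *\<^sub>v y"
    using TP A Pc y by (simp add: assoc_mult_mat_vec[of _ n n _ n])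
  also have "\<dots> = vec n (\<lambda>k. d k * y $ k)"
    unfolding D using y
    by (intro eq_vecI) (auto simp: mat_diag_def scalar_prod_def if_distrib[of "\<lambda>a. a * _"] cong: if_cong)
  also have "y \<bullet> \<dots> = (\<Sum>k<n. d k * (y $ k)\<^sup>2)"
    using y by (simp add: scalar_prod_def lessThan_atLeast0 power2_eq_square mult_ac)
  finally show "x \<bullet> (A *\<^sub>v x) = (\<Sum>k<n. d k * ((transpose_mat P *\<^sub>v x) $ k)\<^sup>2)"
    unfolding y_def .
  have "x \<bullet> x = y \<bullet> (transpose_mat P *\<^sub>v (P *\<^sub>v y))"
    unfolding xy by (rule tr) (use Pc y in simp)
  also have "transpose_mat P *\<^sub>v (P *\<^sub>v y) = y"
    using assoc_mult_mat_vec[OF TP Pc y] TPP y by simp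
  also have "y \<bullet> y = (\<Sum>k<n. (y $ k)\<^sup>2)"
    using y by (simp add: scalar_prod_def lessThan_atLeast0 power2_eq_square)
  finally show "x \<bullet> x = (\<Sum>k<n. ((transpose_mat P *\<^sub>v x) $ k)\<^sup>2)"
    unfolding y_def .
qed

lemma spectral_theorem_sorted:
  fixes A :: "real mat"
  assumes "A \<in> carrier_mat n n" "transpose_mat A = A"
  obtains P where "orthogonal_mat n P"
    "transpose_mat P * A * P = mat_diag n (\<lambda>i. sorted_eigenvalues A ! i)"
  using spectral_theorem[OF assms sorted_eigenvalues_char_poly(1)[OF assms]] by blast

text \<open>One half of Weyl's inequality. Some nonzero x lies in the span of the eigenvectors of A
  from position i on and in the span of those of B up to position i; there the form of A is at
  least, and that of B at most, the i-th eigenvalue times x \<bullet> x.\<close>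

lemma sorted_eigenvalues_le:
  fixes A B :: "real mat"
  assumes A: "A \<in> carrier_mat n n" "transpose_mat A = A"
    and B: "B \<in> carrier_mat n n" "transpose_mat B = B"
    and le: "\<And>x. x \<in> carrier_vec n \<Longrightarrow> x \<bullet> (A *\<^sub>v x) \<le> x \<bullet> (B *\<^sub>v x) + c * (x \<bullet> x)"
    and i: "i < n"
  shows "sorted_eigenvalues A ! i \<le> sorted_eigenvalues B ! i + c"
proof -
  let ?a = "\<lambda>k. sorted_eigenvalues A ! k" and ?b = "\<lambda>k. sorted_eigenvalues B ! k"
  have mono_a: "?a k \<le> ?a l" if "k \<le> l" "l < n" for k l
    using sorted_eigenvalues_char_poly[OF A] that by (auto intro: sorted_nth_mono)
  have mono_b: "?b k \<le> ?b l" if "k \<le> l" "l < n" for k l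
    using sorted_eigenvalues_char_poly[OF B] that by (auto intro: sorted_nth_mono)
  obtain P where P: "orthogonal_mat n P" "transpose_mat P * A * P = mat_diag n ?a"
    using spectral_theorem_sorted[OF A] .
  obtain Q where Q: "orthogonal_mat n Q" "transpose_mat Q * B * Q = mat_diag n ?b"
    using spectral_theorem_sorted[OF B] .
  have Pc: "P \<in> carrier_mat n n" and Qc: "Q \<in> carrier_mat n n"
    using P Q unfolding orthogonal_mat_def by auto
  \<comment> \<open>The kernel of \<open>C\<close> consists of the vectors that are orthogonal to the eigenvectors of \<open>A\<close> before
    position \<open>i\<close> and to those of \<open>B\<close> after it; these are only \<open>n - 1\<close> conditions.\<close>
  define r where "r k = (if k < i then col P k else col Q k)" for k
  define C where "C = mat\<^sub>r n n (\<lambda>k. if k = i then 0\<^sub>v n else r k)"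
  have C: "C \<in> carrier_mat n n" unfolding C_def by simp
  \<comment> \<open>The zero row in slot i forces a nonzero kernel vector; this replaces
    intersecting two subspaces by a dimension count.\<close>
  have "det C = 0"
    unfolding C_def by (rule det_row_0[OF i]) (use Pc Qc in \<open>auto simp: r_def\<close>)
  then obtain x where x: "x \<in> carrier_vec n" "x \<noteq> 0\<^sub>v n" "C *\<^sub>v x = 0\<^sub>v n"
    using det_0_iff_vec_prod_zero[OF C] by blast
  have r0: "r k \<bullet> x = 0" if "k < n" "k \<noteq> i" for k
  proof -
    have "row C k = r k" using that Pc Qc unfolding C_def r_def by auto
    moreover have "(C *\<^sub>v x) $ k = row C k \<bullet> x" using that C by simp
    ultimately show ?thesis using x that by simp
  qed
  have TP0: "(transpose_mat P *\<^sub>v x) $ k = 0" if "k < i" for k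
    using r0[of k] that i Pc unfolding r_def by simp
  have TQ0: "(transpose_mat Q *\<^sub>v x) $ k = 0" if "i < k" "k < n" for k
    using r0[of k] that Qc unfolding r_def by simp
  note quadA = orthogonal_diagonal_quadratic_form[OF P(1) A(1) P(2) x(1)]
  note quadB = orthogonal_diagonal_quadratic_form[OF Q(1) B(1) Q(2) x(1)]
  have "?a i * (x \<bullet> x) \<le> x \<bullet> (A *\<^sub>v x)"
    unfolding quadA sum_distrib_left
  proof (rule sum_mono)
    fix k assume "k \<in> {..<n}"
    thus "?a i * ((transpose_mat P *\<^sub>v x) $ k)\<^sup>2 \<le> ?a k * ((transpose_mat P *\<^sub>v x) $ k)\<^sup>2"
      using TP0[of k] mono_a[of i k] by (cases "k < i") (auto intro: mult_right_mono)
  qed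
  also have "\<dots> \<le> x \<bullet> (B *\<^sub>v x) + c * (x \<bullet> x)" by (rule le[OF x(1)])
  also have "x \<bullet> (B *\<^sub>v x) \<le> ?b i * (x \<bullet> x)"
    unfolding quadB sum_distrib_left
  proof (rule sum_mono)
    fix k assume "k \<in> {..<n}"
    thus "?b k * ((transpose_mat Q *\<^sub>v x) $ k)\<^sup>2 \<le> ?b i * ((transpose_mat Q *\<^sub>v x) $ k)\<^sup>2"
      using TQ0[of k] mono_b[of k i] i by (cases "i < k") (auto intro: mult_right_mono)
  qed
  finally have "?a i * (x \<bullet> x) \<le> (?b i + c) * (x \<bullet> x)" by (simp add: algebra_simps)
  moreover have "x \<bullet> x > 0"
  proof -
    obtain k where "k < n" "x $ k \<noteq> 0"
      using x by (metis carrier_vecD eq_vecI index_zero_vec(1) index_zero_vec(2))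
    hence "(\<Sum>k<n. x $ k * x $ k) > 0"
      by (intro sum_pos2[of _ k]) (auto simp: not_less less_le)
    thus ?thesis using x by (simp add: scalar_prod_def lessThan_atLeast0)
  qed
  ultimately show ?thesis by simp
qed

lemma sorted_eigenvalues_dist_le:
  fixes A B :: "real mat"
  assumes A: "A \<in> carrier_mat n n" "transpose_mat A = A"
    and B: "B \<in> carrier_mat n n" "transpose_mat B = B"
    and le: "\<And>x. x \<in> carrier_vec n \<Longrightarrow> \<bar>x \<bullet> ((A - B) *\<^sub>v x)\<bar> \<le> c * (x \<bullet> x)"
    and i: "i < n"
  shows "\<bar>sorted_eigenvalues A ! i - sorted_eigenvalues B ! i\<bar> \<le> c"
proof -
  have *: "x \<bullet> ((A - B) *\<^sub>v x) = x \<bullet> (A *\<^sub>v x) - x \<bullet> (B *\<^sub>v x)" if "x \<in> carrier_vec n" for x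
    using that A(1) B(1) by (simp add: minus_mult_distrib_mat_vec scalar_prod_minus_distrib[of _ n])
  have "sorted_eigenvalues A ! i \<le> sorted_eigenvalues B ! i + c"
    by (rule sorted_eigenvalues_le[OF A B _ i]) (use le * in \<open>force simp: abs_le_iff\<close>)
  moreover have "sorted_eigenvalues B ! i \<le> sorted_eigenvalues A ! i + c"
    by (rule sorted_eigenvalues_le[OF B A _ i]) (use le * in \<open>force simp: abs_le_iff\<close>)
  ultimately show ?thesis by linarith
qed

section \<open>Bounding a quadratic form by its values on a grid\<close>

lemma quadratic_form_eq_sum:
  fixes A :: "real mat"
  assumes "A \<in> carrier_mat n n" "x \<in> carrier_vec n"
  shows "x \<bullet> (A *\<^sub>v x) = (\<Sum>i<n. \<Sum>j<n. x $ i * x $ j * A $$ (i, j))"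
  using assms by (simp add: scalar_prod_def lessThan_atLeast0 sum_distrib_left mult_ac)

text \<open>The rounded top eigenvector \<open>y = u + e\<close> satisfies
  \<open>y \<bullet> B y = \<lambda> (y \<bullet> y - e \<bullet> e) + e \<bullet> B e\<close>: the rounding error enters only to second order, so a
  grid of mesh \<open>1 / (2 n)\<close> is fine enough.\<close>
lemma quadratic_form_bound_from_grid:
  fixes B :: "real mat"
  assumes B: "B \<in> carrier_mat n n" "transpose_mat B = B" and T: "T > 0"
    and grid: "\<And>(k :: nat \<Rightarrow> int) y. \<forall>i<n. \<bar>k i\<bar> \<le> 2 * int n \<Longrightarrow>
        vec n (\<lambda>i. of_int (k i) / (2 * real n)) = y \<Longrightarrow> y \<bullet> y \<ge> 1 / 2 \<Longrightarrow>
        \<bar>y \<bullet> (B *\<^sub>v y)\<bar> < 3 / 4 * T * (y \<bullet> y)"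
    and x: "x \<in> carrier_vec n"
  shows "\<bar>x \<bullet> (B *\<^sub>v x)\<bar> \<le> T * (x \<bullet> x)"
proof (cases "n = 0")
  case True
  thus ?thesis using B x by (simp add: scalar_prod_def)
next
  case False
  define l where "l k = sorted_eigenvalues B ! k" for k
  obtain P where P: "orthogonal_mat n P" "transpose_mat P * B * P = mat_diag n l"
    using spectral_theorem_sorted[OF B] unfolding l_def by blast
  have Pc: "P \<in> carrier_mat n n" "transpose_mat P \<in> carrier_mat n n"
    and TPP: "transpose_mat P * P = 1\<^sub>m n" and PTP: "P * transpose_mat P = 1\<^sub>m n"
    using P unfolding orthogonal_mat_def by auto
  \<comment> \<open>The operator norm of \<open>B\<close>, attained at an eigenvector.\<close>
  define m where "m = Max ((\<lambda>k. \<bar>l k\<bar>) ` {..<n})"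
  have lm: "\<bar>l k\<bar> \<le> m" if "k < n" for k unfolding m_def using that by simp
  have bound: "\<bar>z \<bullet> (B *\<^sub>v z)\<bar> \<le> m * (z \<bullet> z)" if z: "z \<in> carrier_vec n" for z
  proof -
    note quad = orthogonal_diagonal_quadratic_form[OF P(1) B(1) P(2) z]
    have "\<bar>z \<bullet> (B *\<^sub>v z)\<bar> \<le> (\<Sum>k<n. \<bar>l k * ((transpose_mat P *\<^sub>v z) $ k)\<^sup>2\<bar>)"
      unfolding quad by (rule sum_abs)
    also have "\<dots> \<le> m * (z \<bullet> z)"
      unfolding quad sum_distrib_left
      by (intro sum_mono) (auto simp: abs_mult intro!: mult_right_mono lm)
    finally show ?thesis .
  qed
  have "m \<le> T"
  proof (rule ccontr)
    assume "\<not> m \<le> T"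
    hence mT: "m > T" by simp
    have "m \<in> (\<lambda>k. \<bar>l k\<bar>) ` {..<n}"
      unfolding m_def using False by (intro Max_in) auto
    then obtain k where k: "k < n" "\<bar>l k\<bar> = m" by auto
    define u where "u = col P k"
    have u: "u \<in> carrier_vec n" unfolding u_def using Pc by (intro carrier_vecI) simp
    have "u \<bullet> u = (transpose_mat P * P) $$ (k, k)" unfolding u_def using Pc k by simp
    hence uu: "u \<bullet> u = 1" unfolding TPP using k by simp
    have "B * P = P * (transpose_mat P * B * P)"
    proof -
      have "P * (transpose_mat P * B * P) = (P * transpose_mat P) * (B * P)"
        using Pc B(1) by (simp add: assoc_mult_mat[of _ n n _ n _ n])
      thus ?thesis unfolding PTP using Pc B(1) by simp
    qed
    hence BP: "B * P = P * mat_diag n l" using P(2) by simp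
    have "B *\<^sub>v u = col (B * P) k"
      unfolding u_def using B(1) Pc k by (intro eq_vecI) auto
    also have "\<dots> = l k \<cdot>\<^sub>v u"
      unfolding BP mat_diag_mult_right[OF Pc(1)] u_def using Pc k
      by (intro eq_vecI) (auto simp: mult.commute)
    finally have Bu: "B *\<^sub>v u = l k \<cdot>\<^sub>v u" .
    define q where "q i = round (2 * real n * u $ i)" for i
    define y where "y = vec n (\<lambda>i. of_int (q i) / (2 * real n))"
    have y: "y \<in> carrier_vec n" unfolding y_def by simp
    define e where "e = y - u"
    have e: "e \<in> carrier_vec n" unfolding e_def using y u by simp
    have y_eq: "y = u + e" unfolding e_def using y u by (intro eq_vecI) auto
    have ei: "\<bar>e $ i\<bar> \<le> 1 / (4 * real n)" if "i < n" for i
    proof -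
      have "2 * real n * e $ i = of_int (q i) - 2 * real n * u $ i"
        unfolding e_def y_def using that u False by (simp add: field_simps)
      hence "\<bar>2 * real n * e $ i\<bar> \<le> 1 / 2"
        using of_int_round_abs_le[of "2 * real n * u $ i"] unfolding q_def by simp
      thus ?thesis using False by (simp add: abs_mult field_simps)
    qed
    \<comment> \<open>Rounding moves each of the n coordinates by at most 1 / (4 n), so the squared
      error is at most 1 / (16 n).\<close>
    have ee: "e \<bullet> e \<le> 1 / 16"
    proof -
      have "e \<bullet> e = (\<Sum>i<n. \<bar>e $ i\<bar>\<^sup>2)"
        using e by (simp add: scalar_prod_def lessThan_atLeast0 power2_eq_square)
      also have "\<dots> \<le> (\<Sum>i<n. (1 / (4 * real n))\<^sup>2)"
        by (intro sum_mono power_mono ei) auto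
      also have "\<dots> \<le> 1 / 16" using False by (simp add: field_simps power2_eq_square)
      finally show ?thesis .
    qed
    have ee0: "e \<bullet> e \<ge> 0" using e by (simp add: scalar_prod_def sum_nonneg)
    \<comment> \<open>Coordinatewise, the difference of the two sides is the square of a / 2 + 2 b.
      Together with \<open>ee\<close> this gives y \<bullet> y \<ge> 9 / 16, so the grid point stays
      away from 0.\<close>
    have "3 / 4 * (u \<bullet> u) - 3 * (e \<bullet> e) \<le> y \<bullet> y"
    proof -
      have "3 / 4 * (a * a) - 3 * (b * b) \<le> (a + b) * (a + b)" for a b :: real
        using zero_le_square[of "a / 2 + 2 * b"] by (simp add: field_simps)
      thus ?thesis unfolding y_eq using u e
        by (simp add: scalar_prod_def sum_distrib_left sum_subtractf[symmetric] sum_mono)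
    qed
    hence yy: "y \<bullet> y \<ge> 1 / 2" using uu ee by simp
    have ui: "\<bar>u $ i\<bar> \<le> 1" if "i < n" for i
    proof -
      have "(u $ i)\<^sup>2 \<le> (\<Sum>i<n. (u $ i)\<^sup>2)"
        by (rule member_le_sum) (use that in auto)
      also have "\<dots> = 1" using uu u
        by (simp add: scalar_prod_def lessThan_atLeast0 power2_eq_square)
      finally show ?thesis by (simp add: abs_square_le_1)
    qed
    \<comment> \<open>A unit vector has coordinates in [-1, 1], and rounding is monotone and fixes
      the integers - 2 n and 2 n, so the rounded vector lies in the finite grid.\<close>
    have qi: "\<bar>q i\<bar> \<le> 2 * int n" if "i < n" for i
    proof -
      have upper: "2 * real n * u $ i \<le> real_of_int (2 * int n)"
        using ui[OF that] by (simp add: mult_left_le)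
      have lower: "real_of_int (- 2 * int n) \<le> 2 * real n * u $ i"
        using mult_left_mono[of "- 1" "u $ i" "2 * real n"] ui[OF that] by simp
      show ?thesis
        using round_mono[OF upper] round_mono[OF lower] unfolding q_def round_of_int by simp
    qed
    have "\<bar>y \<bullet> (B *\<^sub>v y)\<bar> < 3 / 4 * T * (y \<bullet> y)"
      by (rule grid[of q]) (use qi yy in \<open>auto simp: y_def\<close>)
    moreover have "3 / 4 * m * (y \<bullet> y) \<le> \<bar>y \<bullet> (B *\<^sub>v y)\<bar>"
    proof -
      have "u \<bullet> (B *\<^sub>v e) = e \<bullet> (B *\<^sub>v u)"
        using transpose_vec_mult_scalar[OF B(1) u e] transpose_vec_mult_scalar[OF B(1) e u] B(2)
          u e B(1) by (metis comm_scalar_prod mult_mat_vec_carrier)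
      hence "y \<bullet> (B *\<^sub>v y) = l k * (y \<bullet> y - e \<bullet> e) + e \<bullet> (B *\<^sub>v e)"
        unfolding y_eq using u e B(1) comm_scalar_prod[OF u e]
        by (simp add: mult_add_distrib_mat_vec[of _ n n] add_scalar_prod_distrib[of _ n]
            scalar_prod_add_distrib[of _ n] Bu algebra_simps)
      moreover have "\<bar>l k * (y \<bullet> y - e \<bullet> e)\<bar> = m * (y \<bullet> y - e \<bullet> e)"
        using yy ee k by (simp add: abs_mult)
      ultimately have "\<bar>y \<bullet> (B *\<^sub>v y)\<bar> \<ge> m * (y \<bullet> y - 2 * (e \<bullet> e))"
        using bound[OF e] by (simp add: algebra_simps)
      \<comment> \<open>The constants meet here: 2 (e \<bullet> e) \<le> 1 / 8, which is a quarter
        of the lower bound 1 / 2 for y \<bullet> y.\<close>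
      moreover have "m * (3 / 4 * (y \<bullet> y)) \<le> m * (y \<bullet> y - 2 * (e \<bullet> e))"
        using yy ee mT T by (intro mult_left_mono) auto
      ultimately show ?thesis by simp
    qed
    moreover have "3 / 4 * T * (y \<bullet> y) \<le> 3 / 4 * m * (y \<bullet> y)"
      using mT yy by (intro mult_right_mono) auto
    ultimately show False by linarith
  qed
  moreover have "x \<bullet> x \<ge> 0" using x by (simp add: scalar_prod_def sum_nonneg)
  ultimately have "m * (x \<bullet> x) \<le> T * (x \<bullet> x)" by (intro mult_right_mono)
  with bound[OF x] show ?thesis by linarith
qed

subsection \<open>Conditional Hoeffding inequality for Bernoulli families\<close>

text \<open>Hoeffding's lemma for a centred Bernoulli variable, with the expectation written out.
  \<open>Hoeffdings_lemma_aux\<close> bounds the logarithm for c \<ge> 0; a negative c is reflected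
  by exchanging p and 1 - p.\<close>

lemma bernoulli_mgf_le:
  fixes p c :: real
  assumes p: "0 \<le> p" "p \<le> 1"
  shows "p * exp (c * (1 - p)) + (1 - p) * exp (- c * p) \<le> exp (c\<^sup>2 / 8)"
proof -
  have pos: "q * exp (h * (1 - q)) + (1 - q) * exp (- h * q) \<le> exp (h\<^sup>2 / 8)"
    if h: "h \<ge> 0" and q: "0 \<le> q" "q \<le> 1" for h q :: real
  proof -
    have "1 + q * (exp h - 1) > 0"
      using h q by (intro add_pos_nonneg mult_nonneg_nonneg) auto
    hence "exp (- h * q + ln (1 + q * (exp h - 1))) = exp (- h * q) * (1 + q * (exp h - 1))"
      by (simp only: exp_add exp_ln)
    also have "\<dots> = q * exp (h * (1 - q)) + (1 - q) * exp (- h * q)"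
      by (simp add: algebra_simps exp_diff exp_minus field_simps)
    finally show ?thesis
      using Hoeffdings_lemma_aux[OF h q(1)] by (metis exp_le_cancel_iff)
  qed
  show ?thesis
    using pos[of c p] pos[of "- c" "1 - p"] p by (cases "c \<ge> 0") (auto simp: algebra_simps)
qed

text \<open>The success probabilities \<open>p k\<close> are F-measurable and lie in [0,1] at every
  outcome, so exponentials in them are bounded and can be moved past the conditional expectation.
  The index set will be the pairs of the upper triangle.\<close>

locale conditional_bernoulli_family = prob_space M + finite_measure_subalgebra M F
  for M :: "'a measure" and F :: "'a measure" +
  fixes Y :: "'i \<Rightarrow> 'a \<Rightarrow> real" and p :: "'i \<Rightarrow> 'a \<Rightarrow> real" and I :: "'i set"
  assumes finite_I: "finite I"
    and cond_indep: "cond_indep_vars M F Y I"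
    and bernoulli: "\<And>k. k \<in> I \<Longrightarrow> cond_bernoulli M F (Y k) (p k)"
    and p_measurable: "\<And>k. k \<in> I \<Longrightarrow> p k \<in> borel_measurable F"
    and p_range: "\<And>k \<omega>. k \<in> I \<Longrightarrow> \<omega> \<in> space M \<Longrightarrow> p k \<omega> \<in> {0..1}"
begin

lemma space_F: "space F = space M"
  using subalg unfolding subalgebra_def by simp

lemma sets_F: "E \<in> sets F \<Longrightarrow> E \<in> sets M"
  using subalg unfolding subalgebra_def by auto

lemma Y_measurable: "k \<in> I \<Longrightarrow> Y k \<in> borel_measurable M"
  and Y_range: "k \<in> I \<Longrightarrow> \<omega> \<in> space M \<Longrightarrow> Y k \<omega> = 0 \<or> Y k \<omega> = 1"
  and Y_cond_exp: "k \<in> I \<Longrightarrow> AE \<omega> in M. real_cond_exp M F (Y k) \<omega> = p k \<omega>"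
  using bernoulli unfolding cond_bernoulli_def by auto

lemma p_measurable_M: "k \<in> I \<Longrightarrow> p k \<in> borel_measurable M"
  using measurable_from_subalg[OF subalg p_measurable] .

text \<open>The cells of the partition of the space by the pattern of ones, when S ranges over the
  subsets of I.\<close>

definition configuration :: "'i set \<Rightarrow> 'a set" where
  "configuration S = {\<omega> \<in> space M. \<forall>k\<in>I. Y k \<omega> = indicator S k}"

text \<open>The product Bernoulli weight of the pattern S, still random through p.\<close>

definition configuration_prob :: "'i set \<Rightarrow> 'a \<Rightarrow> real" where
  "configuration_prob S \<omega> = (\<Prod>k\<in>S. p k \<omega>) * (\<Prod>k\<in>I - S. 1 - p k \<omega>)"

lemma configuration_measurable: "configuration S \<in> sets M"
proof -
  have "{\<omega> \<in> space M. Y k \<omega> = indicator S k} \<in> sets M" if "k \<in> I" for k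
    using Y_measurable[OF that] by measurable
  thus ?thesis unfolding configuration_def by (intro sets.sets_Collect_finite_All finite_I)
qed

text \<open>Conditional independence applied to singletons. For k in S the indicator is
  \<open>Y k\<close> itself, with conditional mean \<open>p k\<close>; for the other k it is 1 -
  \<open>Y k\<close>.\<close>

lemma configuration_cond_exp:
  assumes S: "S \<subseteq> I"
  shows "AE \<omega> in M. real_cond_exp M F (indicator (configuration S)) \<omega> = configuration_prob S \<omega>"
proof -
  define q where "q k \<omega> = (if k \<in> S then p k \<omega> else 1 - p k \<omega>)" for k \<omega>
  have single: "AE \<omega> in M. real_cond_exp M F
      (indicator {\<omega> \<in> space M. Y k \<omega> \<in> {indicator S k}}) \<omega> = q k \<omega>" (is "AE \<omega> in M. real_cond_exp M F ?Z \<omega> = _")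
    if k: "k \<in> I" for k
  proof -
    note [measurable] = Y_measurable[OF k]
    have int: "integrable M (Y k)"
      by (rule integrable_const_bound[of _ 1]) (use Y_range[OF k] in force)+
    have Zm: "?Z \<in> borel_measurable M" by measurable
    show ?thesis
    proof (cases "k \<in> S")
      case True
      have "AE \<omega> in M. real_cond_exp M F ?Z \<omega> = real_cond_exp M F (Y k) \<omega>"
        by (rule real_cond_exp_cong[OF _ Zm])
          (use True Y_range[OF k] in \<open>fastforce simp: indicator_def\<close>)+
      with Y_cond_exp[OF k] show ?thesis by eventually_elim (use True in \<open>simp add: q_def\<close>)
    next
      case False
      have "AE \<omega> in M. real_cond_exp M F ?Z \<omega> = real_cond_exp M F (\<lambda>\<omega>. 1 - Y k \<omega>) \<omega>"
        by (rule real_cond_exp_cong[OF _ Zm])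
          (use False Y_range[OF k] in \<open>fastforce simp: indicator_def\<close>)+
      moreover have "AE \<omega> in M. real_cond_exp M F (\<lambda>\<omega>. 1 - Y k \<omega>) \<omega>
          = real_cond_exp M F (\<lambda>_. 1) \<omega> - real_cond_exp M F (Y k) \<omega>"
        by (rule real_cond_exp_diff) (use int in auto)
      moreover have "AE \<omega> in M. real_cond_exp M F (\<lambda>_. 1) \<omega> = 1"
        by (rule real_cond_exp_F_meas) auto
      ultimately show ?thesis using Y_cond_exp[OF k]
        by eventually_elim (use False in \<open>simp add: q_def\<close>)
    qed
  qed
  have "configuration S = {\<omega> \<in> space M. \<forall>k\<in>I. Y k \<omega> \<in> {indicator S k}}"
    unfolding configuration_def by auto
  hence "AE \<omega> in M. real_cond_exp M F (indicator (configuration S)) \<omega>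
      = (\<Prod>k\<in>I. real_cond_exp M F (indicator {\<omega> \<in> space M. Y k \<omega> \<in> {indicator S k}}) \<omega>)"
    using cond_indep[unfolded cond_indep_vars_def, THEN conjunct2, rule_format, of I "\<lambda>k. {indicator S k}"]
      finite_I by simp
  moreover have "AE \<omega> in M. \<forall>k\<in>I. real_cond_exp M F
      (indicator {\<omega> \<in> space M. Y k \<omega> \<in> {indicator S k}}) \<omega> = q k \<omega>"
    using finite_I single by (simp add: AE_finite_all)
  ultimately show ?thesis
  proof eventually_elim
    case (elim \<omega>)
    have "configuration_prob S \<omega> = (\<Prod>k\<in>I. q k \<omega>)"
      using prod.subset_diff[OF S finite_I, of "\<lambda>k. q k \<omega>"]
      unfolding configuration_prob_def by (simp add: q_def mult.commute)
    thus ?case using elim by simp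
  qed
qed

lemma exp_sum_integrable:
  "integrable M (\<lambda>\<omega>. exp (\<Sum>k\<in>I. c k * (Y k \<omega> - p k \<omega>)))"
proof (rule integrable_const_bound)
  show "(\<lambda>\<omega>. exp (\<Sum>k\<in>I. c k * (Y k \<omega> - p k \<omega>))) \<in> borel_measurable M"
    using Y_measurable p_measurable_M by measurable
  show "AE \<omega> in M. norm (exp (\<Sum>k\<in>I. c k * (Y k \<omega> - p k \<omega>))) \<le> exp (\<Sum>k\<in>I. \<bar>c k\<bar>)"
  proof (rule AE_I2)
    fix \<omega> assume \<omega>: "\<omega> \<in> space M"
    have "c k * (Y k \<omega> - p k \<omega>) \<le> \<bar>c k\<bar>" if "k \<in> I" for k
    proof -
      have "\<bar>Y k \<omega> - p k \<omega>\<bar> \<le> 1" using Y_range[OF that \<omega>] p_range[OF that \<omega>] by auto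
      hence "\<bar>c k * (Y k \<omega> - p k \<omega>)\<bar> \<le> \<bar>c k\<bar> * 1"
        unfolding abs_mult by (intro mult_left_mono) auto
      thus ?thesis by linarith
    qed
    thus "norm (exp (\<Sum>k\<in>I. c k * (Y k \<omega> - p k \<omega>))) \<le> exp (\<Sum>k\<in>I. \<bar>c k\<bar>)"
      by (simp add: sum_mono)
  qed
qed

text \<open>On a configuration the \<open>Y k\<close> are constants, so the exponential becomes the
  F-measurable \<open>h S\<close>, and the indicator of the configuration may be replaced by its
  conditional expectation. Summed over all S, the weights factor into one moment generating function
  per index.\<close>

lemma exp_sum_integral_le:
  assumes E: "E \<in> sets F"
  shows "(\<integral>\<omega>. indicator E \<omega> * exp (\<Sum>k\<in>I. c k * (Y k \<omega> - p k \<omega>)) \<partial>M)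
    \<le> exp ((\<Sum>k\<in>I. (c k)\<^sup>2) / 8) * prob E"
proof -
  have EM [measurable]: "E \<in> sets M" using sets_F[OF E] .
  define h where "h S \<omega> = indicator E \<omega> * exp (\<Sum>k\<in>I. c k * (indicator S k - p k \<omega>))"
    for S \<omega>
  have hF: "h S \<in> borel_measurable F" for S
    unfolding h_def using E p_measurable by measurable
  have hM: "h S \<in> borel_measurable M" for S
    using measurable_from_subalg[OF subalg hF] .
  have h_bound: "\<bar>h S \<omega>\<bar> \<le> exp (\<Sum>k\<in>I. \<bar>c k\<bar>)" if \<omega>: "\<omega> \<in> space M" for S \<omega>
  proof -
    have "c k * (indicator S k - p k \<omega>) \<le> \<bar>c k\<bar>" if "k \<in> I" for k
    proof -
      have "\<bar>indicator S k - p k \<omega>\<bar> \<le> 1" using p_range[OF that \<omega>] by (auto simp: indicator_def)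
      hence "\<bar>c k * (indicator S k - p k \<omega>)\<bar> \<le> \<bar>c k\<bar> * 1"
        unfolding abs_mult by (intro mult_left_mono) auto
      thus ?thesis by linarith
    qed
    thus ?thesis unfolding h_def by (simp add: indicator_def sum_mono)
  qed
  have int: "integrable M (\<lambda>\<omega>. h S \<omega> * indicator (configuration S) \<omega>)" for S
    by (rule integrable_const_bound[of _ "exp (\<Sum>k\<in>I. \<bar>c k\<bar>)"])
      (use h_bound hM configuration_measurable in \<open>auto simp: indicator_def\<close>)
  have cm: "indicator (configuration S) \<in> borel_measurable M" for S
    using configuration_measurable by measurable
  \<comment> \<open>The defining property of the conditional expectation, with \<open>h S\<close> as
    the F-measurable test function.\<close>
  have step: "(\<integral>\<omega>. h S \<omega> * indicator (configuration S) \<omega> \<partial>M) = (\<integral>\<omega>. h S \<omega> * configuration_prob S \<omega> \<partial>M)"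
    "integrable M (\<lambda>\<omega>. h S \<omega> * configuration_prob S \<omega>)"
    if S: "S \<in> Pow I" for S
  proof -
    have ae: "AE \<omega> in M. h S \<omega> * real_cond_exp M F (indicator (configuration S)) \<omega>
        = h S \<omega> * configuration_prob S \<omega>"
      using configuration_cond_exp[of S] S by auto
    have m: "(\<lambda>\<omega>. h S \<omega> * configuration_prob S \<omega>) \<in> borel_measurable M"
      unfolding configuration_prob_def
      using hM[of S] S p_measurable_M by (intro borel_measurable_times borel_measurable_prod borel_measurable_diff) auto
    have m': "(\<lambda>\<omega>. h S \<omega> * real_cond_exp M F (indicator (configuration S)) \<omega>) \<in> borel_measurable M"
      using hM[of S] by measurable
    note intg = real_cond_exp_intg[OF int[of S] hF[of S] cm[of S]]
    show "integrable M (\<lambda>\<omega>. h S \<omega> * configuration_prob S \<omega>)"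
      using integrable_cong_AE[OF m' m ae] intg(1) by simp
    show "(\<integral>\<omega>. h S \<omega> * indicator (configuration S) \<omega> \<partial>M) = (\<integral>\<omega>. h S \<omega> * configuration_prob S \<omega> \<partial>M)"
      using integral_cong_AE[OF m' m ae] intg(2) by simp
  qed
  have "(\<integral>\<omega>. indicator E \<omega> * exp (\<Sum>k\<in>I. c k * (Y k \<omega> - p k \<omega>)) \<partial>M)
    = (\<integral>\<omega>. (\<Sum>S\<in>Pow I. h S \<omega> * indicator (configuration S) \<omega>) \<partial>M)"
  proof (rule Bochner_Integration.integral_cong[OF refl])
    fix \<omega> assume \<omega>: "\<omega> \<in> space M"
    \<comment> \<open>The one pattern realised at this outcome; all other terms of the sum
      vanish.\<close>
    define T where "T = {k \<in> I. Y k \<omega> = 1}"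
    have Y: "Y k \<omega> = indicator T k" if "k \<in> I" for k
      using Y_range[OF that \<omega>] that unfolding T_def by (auto simp: indicator_def)
    have conf: "\<omega> \<in> configuration S \<longleftrightarrow> S = T" if "S \<in> Pow I" for S
    proof
      assume "\<omega> \<in> configuration S"
      hence "(indicator S k :: real) = indicator T k" if "k \<in> I" for k
        using Y[OF that] that unfolding configuration_def by auto
      hence "k \<in> S \<longleftrightarrow> k \<in> T" if "k \<in> I" for k
        using that by (metis indicator_eq_1_iff)
      thus "S = T" using that unfolding T_def by blast
    qed (use Y \<omega> in \<open>auto simp: configuration_def\<close>)
    have "(\<Sum>S\<in>Pow I. h S \<omega> * indicator (configuration S) \<omega>) = (\<Sum>S\<in>Pow I. if S = T then h S \<omega> else 0)"
      by (rule sum.cong) (simp_all add: conf indicator_def)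
    also have "\<dots> = h T \<omega>"
      using finite_I by (simp add: T_def)
    finally show "indicator E \<omega> * exp (\<Sum>k\<in>I. c k * (Y k \<omega> - p k \<omega>))
        = (\<Sum>S\<in>Pow I. h S \<omega> * indicator (configuration S) \<omega>)"
      unfolding h_def using Y by simp
  qed
  also have "\<dots> = (\<Sum>S\<in>Pow I. \<integral>\<omega>. h S \<omega> * configuration_prob S \<omega> \<partial>M)"
    by (subst Bochner_Integration.integral_sum[OF int]) (simp add: step)
  also have "\<dots> = (\<integral>\<omega>. (\<Sum>S\<in>Pow I. h S \<omega> * configuration_prob S \<omega>) \<partial>M)"
    using step(2) by (subst Bochner_Integration.integral_sum) auto
  also have "\<dots> \<le> (\<integral>\<omega>. exp ((\<Sum>k\<in>I. (c k)\<^sup>2) / 8) * indicator E \<omega> \<partial>M)"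
  proof (rule integral_mono)
    show "integrable M (\<lambda>\<omega>. \<Sum>S\<in>Pow I. h S \<omega> * configuration_prob S \<omega>)"
      using step(2) by (intro Bochner_Integration.integrable_sum)
    show "integrable M (\<lambda>\<omega>. exp ((\<Sum>k\<in>I. (c k)\<^sup>2) / 8) * indicator E \<omega> :: real)"
      using EM by (intro integrable_mult_right integrable_real_indicator) (auto simp: less_top[symmetric])
    fix \<omega> assume \<omega>: "\<omega> \<in> space M"
    have "h S \<omega> * configuration_prob S \<omega> = indicator E \<omega> *
        ((\<Prod>k\<in>S. p k \<omega> * exp (c k * (1 - p k \<omega>))) * (\<Prod>k\<in>I - S. (1 - p k \<omega>) * exp (- c k * p k \<omega>)))"
      if "S \<in> Pow I" for S
    proof -
      have "exp (\<Sum>k\<in>I. c k * (indicator S k - p k \<omega>))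
          = (\<Prod>k\<in>I - S. exp (c k * (indicator S k - p k \<omega>))) * (\<Prod>k\<in>S. exp (c k * (indicator S k - p k \<omega>)))"
        using that finite_I by (simp add: exp_sum prod.subset_diff[of S])
      thus ?thesis
        unfolding h_def configuration_prob_def by (simp add: prod.distrib mult_ac)
    qed
    \<comment> \<open>By \<open>prod_add\<close>, the sum over subsets is the expansion of a product
      of two-term sums.\<close>
    hence "(\<Sum>S\<in>Pow I. h S \<omega> * configuration_prob S \<omega>) = indicator E \<omega> *
        (\<Prod>k\<in>I. p k \<omega> * exp (c k * (1 - p k \<omega>)) + (1 - p k \<omega>) * exp (- c k * p k \<omega>))"
      by (simp add: prod_add[OF finite_I] sum_distrib_left)
    also have "\<dots> \<le> indicator E \<omega> * (\<Prod>k\<in>I. exp ((c k)\<^sup>2 / 8))"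
    proof (intro mult_left_mono prod_mono conjI)
      fix k assume "k \<in> I"
      hence "0 \<le> p k \<omega>" "p k \<omega> \<le> 1" using p_range \<omega> by auto
      thus "p k \<omega> * exp (c k * (1 - p k \<omega>)) + (1 - p k \<omega>) * exp (- c k * p k \<omega>) \<le> exp ((c k)\<^sup>2 / 8)"
        "0 \<le> p k \<omega> * exp (c k * (1 - p k \<omega>)) + (1 - p k \<omega>) * exp (- c k * p k \<omega>)"
        using bernoulli_mgf_le[of "p k \<omega>" "c k"] by auto
    qed simp
    finally show "(\<Sum>S\<in>Pow I. h S \<omega> * configuration_prob S \<omega>) \<le> exp ((\<Sum>k\<in>I. (c k)\<^sup>2) / 8) * indicator E \<omega>"
      using finite_I by (simp add: exp_sum sum_divide_distrib mult.commute)
  qed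
  also have "\<dots> = exp ((\<Sum>k\<in>I. (c k)\<^sup>2) / 8) * prob E"
    using EM by simp
  finally show ?thesis .
qed

lemma conditional_Hoeffding_ge:
  assumes E: "E \<in> sets F" and V: "(\<Sum>k\<in>I. (c k)\<^sup>2) \<le> V" "V > 0" and t: "t \<ge> 0"
  shows "prob {\<omega> \<in> E. t \<le> (\<Sum>k\<in>I. c k * (Y k \<omega> - p k \<omega>))} \<le> exp (- 2 * t\<^sup>2 / V) * prob E"
proof -
  \<comment> \<open>The Chernoff parameter that minimises s^2 V / 8 - s t.\<close>
  define s where "s = 4 * t / V"
  let ?Z = "\<lambda>\<omega>. \<Sum>k\<in>I. c k * (Y k \<omega> - p k \<omega>)"
  let ?A = "{\<omega> \<in> E. t \<le> ?Z \<omega>}"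
  have EM [measurable]: "E \<in> sets M" using sets_F[OF E] .
  have sZ: "s * ?Z \<omega> = (\<Sum>k\<in>I. (s * c k) * (Y k \<omega> - p k \<omega>))" for \<omega>
    by (simp add: sum_distrib_left mult_ac)
  have [measurable]: "?Z \<in> borel_measurable M"
    using Y_measurable p_measurable_M by measurable
  have "?A = E \<inter> {\<omega> \<in> space M. t \<le> ?Z \<omega>}"
    using sets.sets_into_space[OF EM] by auto
  also have "\<dots> \<in> sets M" by measurable
  finally have A: "?A \<in> sets M" .
  have "exp (s * t) * prob ?A = (\<integral>\<omega>. exp (s * t) * indicator ?A \<omega> \<partial>M)" using A by simp
  also have "\<dots> \<le> (\<integral>\<omega>. indicator E \<omega> * exp (s * ?Z \<omega>) \<partial>M)"
  proof (rule integral_mono)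
    show "integrable M (\<lambda>\<omega>. exp (s * t) * indicator ?A \<omega> :: real)"
      using A by (intro integrable_mult_right integrable_real_indicator) (auto simp: less_top[symmetric])
    show "integrable M (\<lambda>\<omega>. indicator E \<omega> * exp (s * ?Z \<omega>))"
      unfolding sZ using integrable_mult_indicator[OF EM exp_sum_integrable] by simp
    fix \<omega>
    have "s * t \<le> s * ?Z \<omega>" if "t \<le> ?Z \<omega>"
      using that V t unfolding s_def by (intro mult_left_mono) auto
    thus "exp (s * t) * indicator ?A \<omega> \<le> indicator E \<omega> * exp (s * ?Z \<omega>)"
      by (auto simp: indicator_def)
  qed
  also have "\<dots> \<le> exp ((\<Sum>k\<in>I. (s * c k)\<^sup>2) / 8) * prob E"
    unfolding sZ by (rule exp_sum_integral_le[OF E])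
  also have "\<dots> \<le> exp (s\<^sup>2 * V / 8) * prob E"
    using V by (intro mult_right_mono)
      (auto simp: power_mult_distrib sum_distrib_left[symmetric] intro!: mult_left_mono)
  finally have "prob ?A \<le> exp (s\<^sup>2 * V / 8) * prob E / exp (s * t)"
    by (simp add: field_simps)
  also have "\<dots> = exp (s\<^sup>2 * V / 8 - s * t) * prob E" by (simp add: exp_diff)
  also have "s\<^sup>2 * V / 8 - s * t = - 2 * t\<^sup>2 / V"
    using V unfolding s_def by (simp add: field_simps power2_eq_square)
  finally show ?thesis .
qed

theorem conditional_Hoeffding:
  assumes E: "E \<in> sets F" and V: "(\<Sum>k\<in>I. (c k)\<^sup>2) \<le> V" "V > 0" and t: "t \<ge> 0"
  shows "{\<omega> \<in> E. t \<le> \<bar>\<Sum>k\<in>I. c k * (Y k \<omega> - p k \<omega>)\<bar>} \<in> sets M" (is "?A \<in> _")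
    and "prob {\<omega> \<in> E. t \<le> \<bar>\<Sum>k\<in>I. c k * (Y k \<omega> - p k \<omega>)\<bar>} \<le> 2 * exp (- 2 * t\<^sup>2 / V) * prob E"
proof -
  have EM [measurable]: "E \<in> sets M" using sets_F[OF E] .
  have [measurable]: "(\<lambda>\<omega>. \<Sum>k\<in>I. d k * (Y k \<omega> - p k \<omega>)) \<in> borel_measurable M" for d :: "'i \<Rightarrow> real"
    using Y_measurable p_measurable_M by measurable
  let ?B = "\<lambda>d. {\<omega> \<in> E. t \<le> (\<Sum>k\<in>I. d k * (Y k \<omega> - p k \<omega>))}"
  have B: "?B d \<in> sets M" for d :: "'i \<Rightarrow> real"
  proof -
    have "?B d = E \<inter> {\<omega> \<in> space M. t \<le> (\<Sum>k\<in>I. d k * (Y k \<omega> - p k \<omega>))}"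
      using sets.sets_into_space[OF EM] by auto
    also have "\<dots> \<in> sets M" by measurable
    finally show ?thesis .
  qed
  have neg: "(\<Sum>k\<in>I. - c k * (Y k \<omega> - p k \<omega>)) = - (\<Sum>k\<in>I. c k * (Y k \<omega> - p k \<omega>))" for \<omega>
    by (simp add: sum_negf)
  have A: "?A = ?B c \<union> ?B (\<lambda>k. - c k)"
    unfolding neg by (auto simp: abs_if split: if_splits)
  show "?A \<in> sets M" unfolding A by (intro sets.Un B)
  have "prob ?A \<le> prob (?B c) + prob (?B (\<lambda>k. - c k))"
    unfolding A by (intro measure_Un_le B)
  also have "\<dots> \<le> exp (- 2 * t\<^sup>2 / V) * prob E + exp (- 2 * t\<^sup>2 / V) * prob E"
    by (intro add_mono conditional_Hoeffding_ge E V t) (use V in auto)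
  finally show "prob ?A \<le> 2 * exp (- 2 * t\<^sup>2 / V) * prob E" by (simp add: mult_ac)
qed

end

subsection \<open>Sums over the upper triangle and measurability of order statistics\<close>

lemma upper_triangle_Suc:
  "{(i, j). i \<le> j \<and> j < Suc n} = {(i, j). i \<le> j \<and> j < n} \<union> (\<lambda>i. (i, n)) ` {..n}"
  by (auto simp: less_Suc_eq)

lemma finite_upper_triangle: "finite {(i, j). i \<le> j \<and> j < (n :: nat)}"
  by (rule finite_subset[of _ "{..<n} \<times> {..<n}"]) auto

text \<open>Only the entries with i \<le> j are conditionally independent, so a linear form in a
  symmetric g with arbitrary coefficients f is folded onto them. Each induction step adds the last
  row and column.\<close>

lemma sum_symmetric_upper_triangle:
  fixes f g :: "nat \<Rightarrow> nat \<Rightarrow> real"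
  assumes "\<And>a b. a < n \<Longrightarrow> b < n \<Longrightarrow> g a b = g b a"
  shows "(\<Sum>a<n. \<Sum>b<n. f a b * g a b)
    = (\<Sum>(a, b)\<in>{(i, j). i \<le> j \<and> j < n}. (if a = b then f a a else f a b + f b a) * g a b)"
  using assms
proof (induction n)
  case (Suc n)
  let ?h = "\<lambda>(a, b). (if a = b then f a a else f a b + f b a) * g a b"
  have "(\<Sum>p\<in>{(i, j). i \<le> j \<and> j < Suc n}. ?h p)
      = (\<Sum>p\<in>{(i, j). i \<le> j \<and> j < n}. ?h p) + (\<Sum>p\<in>(\<lambda>i. (i, n)) ` {..n}. ?h p)"
    unfolding upper_triangle_Suc
    by (rule sum.union_disjoint) (auto intro: finite_upper_triangle)
  also have "(\<Sum>p\<in>(\<lambda>i. (i, n)) ` {..n}. ?h p) = (\<Sum>a\<le>n. ?h (a, n))"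
    by (subst sum.reindex) (auto simp: inj_on_def)
  also have "\<dots> = (\<Sum>a<n. (f a n + f n a) * g a n) + f n n * g n n"
    by (simp add: lessThan_Suc_atMost[symmetric])
  also have "(\<Sum>a<n. (f a n + f n a) * g a n) = (\<Sum>a<n. f a n * g a n) + (\<Sum>a<n. f n a * g n a)"
    by (simp add: distrib_right sum.distrib Suc.prems[of _ n])
  also have "(\<Sum>p\<in>{(i, j). i \<le> j \<and> j < n}. ?h p) = (\<Sum>a<n. \<Sum>b<n. f a b * g a b)"
    using Suc by simp
  finally show ?case by (simp add: sum.distrib)
qed simp

text \<open>By (x + y)^2 \<le> 2 (x^2 + y^2) off the diagonal; the factor 2 is the price of symmetry
  in \<open>deviation_bound\<close>.\<close>

lemma sum_upper_triangle_square_le: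
  fixes f :: "nat \<Rightarrow> nat \<Rightarrow> real"
  shows "(\<Sum>(a, b)\<in>{(i, j). i \<le> j \<and> j < n}. (if a = b then f a a else f a b + f b a)\<^sup>2)
    \<le> 2 * (\<Sum>a<n. \<Sum>b<n. (f a b)\<^sup>2)"
proof -
  \<comment> \<open>The folding identity with the constant 1 as symmetric factor.\<close>
  have "(\<Sum>a<n. \<Sum>b<n. (f a b)\<^sup>2)
      = (\<Sum>(a, b)\<in>{(i, j). i \<le> j \<and> j < n}. if a = b then (f a a)\<^sup>2 else (f a b)\<^sup>2 + (f b a)\<^sup>2)"
    using sum_symmetric_upper_triangle[of n "\<lambda>_ _. 1" "\<lambda>a b. (f a b)\<^sup>2"] by simp
  moreover have "(x + y)\<^sup>2 \<le> 2 * (x\<^sup>2 + y\<^sup>2)" for x y :: real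
    using zero_le_power2[of "x - y"] by (simp add: power2_eq_square algebra_simps)
  ultimately show ?thesis
    by (auto simp: sum_distrib_left intro!: sum_mono)
qed

section \<open>Order statistics\<close>

lemma sorted_nth_le_iff:
  fixes xs :: "'a :: linorder list"
  assumes "sorted xs" "i < length xs"
  shows "xs ! i \<le> v \<longleftrightarrow> i < length (filter (\<lambda>x. x \<le> v) xs)"
  using assms
proof (induction xs arbitrary: i)
  case (Cons x xs)
  show ?case
  proof (cases "x \<le> v")
    case True
    thus ?thesis using Cons by (cases i) auto
  next
    case False
    hence "filter (\<lambda>x. x \<le> v) (x # xs) = []" "\<not> (x # xs) ! i \<le> v"
      using Cons.prems by (fastforce simp: filter_empty_conv nth_Cons split: nat.splits dest: nth_mem)+
    thus ?thesis by simp
  qed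
qed simp

text \<open>Counting avoids matching two sorting permutations: with v the value at position i (from
  0) of the sorted e', more than i indices have e' j \<le> v, and each of them has e j \<le> v +
  c.\<close>

lemma sort_nth_mono:
  fixes e e' :: "nat \<Rightarrow> real"
  assumes le: "\<And>j. j < n \<Longrightarrow> e j \<le> e' j + c" and i: "i < n"
  shows "sort (map e [0..<n]) ! i \<le> sort (map e' [0..<n]) ! i + c"
proof -
  define v where "v = sort (map e' [0..<n]) ! i"
  have len: "length (filter P (sort xs)) = length (filter P xs)" for P and xs :: "real list"
    by (metis mset_filter mset_sort size_mset)
  have "i < length (filter (\<lambda>x. x \<le> v) (map e' [0..<n]))"
    using sorted_nth_le_iff[of "sort (map e' [0..<n])" i v] i by (simp add: v_def len)
  also have "\<dots> = card {j. j < n \<and> e' j \<le> v}"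
    by (simp add: filter_map o_def length_filter_conv_card cong: conj_cong)
  also have "\<dots> \<le> card {j. j < n \<and> e j \<le> v + c}"
    by (rule card_mono) (use le in force)+
  also have "\<dots> = length (filter (\<lambda>x. x \<le> v + c) (map e [0..<n]))"
    by (simp add: filter_map o_def length_filter_conv_card cong: conj_cong)
  finally show ?thesis
    using sorted_nth_le_iff[of "sort (map e [0..<n])" i "v + c"] i by (simp add: v_def len)
qed

lemma sort_nth_dist_le:
  fixes e e' :: "nat \<Rightarrow> real"
  assumes le: "\<And>j. j < n \<Longrightarrow> \<bar>e j - e' j\<bar> \<le> c" and i: "i < n"
  shows "\<bar>sort (map e [0..<n]) ! i - sort (map e' [0..<n]) ! i\<bar> \<le> c"
proof -
  have "sort (map e [0..<n]) ! i \<le> sort (map e' [0..<n]) ! i + c"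
    by (rule sort_nth_mono[OF _ i]) (use le in \<open>force simp: abs_le_iff\<close>)
  moreover have "sort (map e' [0..<n]) ! i \<le> sort (map e [0..<n]) ! i + c"
    by (rule sort_nth_mono[OF _ i]) (use le in \<open>force simp: abs_le_iff\<close>)
  ultimately show ?thesis by linarith
qed

section \<open>Measurability of order statistics and eigenvalues\<close>

lemma continuous_on_if_dist_le_sum:
  fixes G :: "('i \<Rightarrow> real) \<Rightarrow> real"
  assumes "\<And>e e'. \<bar>G e - G e'\<bar> \<le> (\<Sum>k\<in>K. \<bar>e k - e' k\<bar>)"
  shows "continuous_on UNIV G"
  unfolding continuous_on_def
proof
  fix e :: "'i \<Rightarrow> real"
  have coord: "((\<lambda>e'. e' k) \<longlongrightarrow> e k) (at e)" for k
    using continuous_on_product_coordinates[of k] unfolding continuous_on_def by blast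
  have "((\<lambda>e'. \<Sum>k\<in>K. \<bar>e' k - e k\<bar>) \<longlongrightarrow> (\<Sum>k\<in>K. \<bar>e k - e k\<bar>)) (at e)"
    by (intro tendsto_intros coord)
  hence "((\<lambda>e'. G e' - G e) \<longlongrightarrow> 0) (at e)"
    by (rule Lim_null_comparison[rotated, OF tendsto_eq_rhs])
      (use assms in \<open>auto intro!: always_eventually\<close>)
  thus "(G \<longlongrightarrow> G e) (at e within UNIV)" by (simp add: LIM_zero_iff)
qed

text \<open>Sorting and eigenvalues lack a convenient formula, but both are Lipschitz in finitely
  many real inputs. The bound gives continuity for the product topology, and for a countable index
  type coordinatewise measurability implies Borel measurability into the function space.\<close>

lemma measurable_if_dist_le_sum:
  fixes G :: "('i :: countable \<Rightarrow> real) \<Rightarrow> real"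
  assumes "\<And>e e'. \<bar>G e - G e'\<bar> \<le> (\<Sum>k\<in>K. \<bar>e k - e' k\<bar>)"
    and "\<And>k. (\<lambda>\<omega>. Z \<omega> k) \<in> borel_measurable M"
  shows "(\<lambda>\<omega>. G (Z \<omega>)) \<in> borel_measurable M"
  using measurable_coordinatewise_then_product[of Z M, OF assms(2)]
    borel_measurable_continuous_onI[OF continuous_on_if_dist_le_sum[of G K, OF assms(1)]]
  by (rule measurable_compose)

lemma measurable_sort_nth:
  fixes f :: "nat \<Rightarrow> 'a \<Rightarrow> real"
  assumes f: "\<And>j. j < n \<Longrightarrow> f j \<in> borel_measurable M" and i: "i < n"
  shows "(\<lambda>\<omega>. sort (map (\<lambda>j. f j \<omega>) [0..<n]) ! i) \<in> borel_measurable M"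
proof -
  \<comment> \<open>Coordinates from n on are set to 0, as every coordinate has to be measurable;
    the list never reads them.\<close>
  let ?Z = "\<lambda>\<omega> j. if j < n then f j \<omega> else 0"
  have "(\<lambda>\<omega>. sort (map (?Z \<omega>) [0..<n]) ! i) \<in> borel_measurable M"
  proof (rule measurable_if_dist_le_sum[where Z = ?Z and K = "{..<n}"
      and G = "\<lambda>e. sort (map e [0..<n]) ! i"])
    fix e e' :: "nat \<Rightarrow> real"
    show "\<bar>sort (map e [0..<n]) ! i - sort (map e' [0..<n]) ! i\<bar> \<le> (\<Sum>k<n. \<bar>e k - e' k\<bar>)"
      by (rule sort_nth_dist_le[OF _ i]) (auto intro: member_le_sum[of _ _ "\<lambda>k. \<bar>e k - e' k\<bar>"])
  next
    fix k show "(\<lambda>\<omega>. ?Z \<omega> k) \<in> borel_measurable M" using f by (cases "k < n") auto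
  qed
  moreover have "map (?Z \<omega>) [0..<n] = map (\<lambda>j. f j \<omega>) [0..<n]" for \<omega>
    by simp
  ultimately show ?thesis by (simp only:)
qed

text \<open>A crude bound, but by the entrywise l1 norm, the one in which
  \<open>measurable_if_dist_le_sum\<close> is phrased.\<close>

lemma quadratic_form_le_sum_abs:
  fixes B :: "real mat"
  assumes B: "B \<in> carrier_mat n n" and x: "x \<in> carrier_vec n"
  shows "\<bar>x \<bullet> (B *\<^sub>v x)\<bar> \<le> (\<Sum>i<n. \<Sum>j<n. \<bar>B $$ (i, j)\<bar>) * (x \<bullet> x)"
proof -
  have xx: "x \<bullet> x = (\<Sum>k<n. (x $ k)\<^sup>2)"
    using x by (simp add: scalar_prod_def lessThan_atLeast0 power2_eq_square)
  have sq: "(x $ i)\<^sup>2 \<le> x \<bullet> x" if "i < n" for i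
    unfolding xx by (rule member_le_sum) (use that in auto)
  have "\<bar>x $ i * x $ j\<bar> \<le> x \<bullet> x" if "i < n" "j < n" for i j
  proof -
    have "2 * \<bar>x $ i * x $ j\<bar> \<le> (x $ i)\<^sup>2 + (x $ j)\<^sup>2"
      using zero_le_power2[of "\<bar>x $ i\<bar> - \<bar>x $ j\<bar>"]
      by (simp add: power2_eq_square algebra_simps abs_mult)
    with sq[OF that(1)] sq[OF that(2)] show ?thesis by linarith
  qed
  hence "\<bar>x $ i * x $ j * B $$ (i, j)\<bar> \<le> \<bar>B $$ (i, j)\<bar> * (x \<bullet> x)" if "i < n" "j < n" for i j
    using that unfolding abs_mult[of _ "B $$ (i, j)"] mult.commute[of _ "\<bar>B $$ (i, j)\<bar>"]
    by (intro mult_left_mono) auto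
  hence "(\<Sum>i<n. \<Sum>j<n. \<bar>x $ i * x $ j * B $$ (i, j)\<bar>) \<le> (\<Sum>i<n. \<Sum>j<n. \<bar>B $$ (i, j)\<bar> * (x \<bullet> x))"
    by (intro sum_mono) auto
  moreover have "\<bar>\<Sum>i<n. \<Sum>j<n. x $ i * x $ j * B $$ (i, j)\<bar>
      \<le> (\<Sum>i<n. \<Sum>j<n. \<bar>x $ i * x $ j * B $$ (i, j)\<bar>)"
    by (intro order_trans[OF sum_abs] sum_mono sum_abs)
  ultimately show ?thesis
    unfolding quadratic_form_eq_sum[OF B x] by (simp add: sum_distrib_right)
qed

lemma measurable_sorted_eigenvalues:
  fixes C :: "'a \<Rightarrow> real mat"
  assumes C: "\<And>\<omega>. \<omega> \<in> space M \<Longrightarrow> C \<omega> \<in> carrier_mat n n"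
    and sym: "\<And>\<omega>. \<omega> \<in> space M \<Longrightarrow> transpose_mat (C \<omega>) = C \<omega>"
    and meas: "\<And>a b. a < n \<Longrightarrow> b < n \<Longrightarrow> (\<lambda>\<omega>. C \<omega> $$ (a, b)) \<in> borel_measurable M"
    and i: "i < n"
  shows "(\<lambda>\<omega>. sorted_eigenvalues (C \<omega>) ! i) \<in> borel_measurable M"
proof -
  \<comment> \<open>The Lipschitz function must be defined on all arrays, whereas eigenvalue
    perturbation is available for symmetric matrices. Symmetrizing bridges the gap and fixes the
    values of C.\<close>
  define S :: "(nat \<times> nat \<Rightarrow> real) \<Rightarrow> real mat"
    where "S e = mat n n (\<lambda>(a, b). (e (a, b) + e (b, a)) / 2)" for e
  have S: "S e \<in> carrier_mat n n" "transpose_mat (S e) = S e" for e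
    unfolding S_def by (auto intro!: eq_matI)
  let ?Z = "\<lambda>\<omega> p. if fst p < n \<and> snd p < n then C \<omega> $$ p else 0"
  have "(\<lambda>\<omega>. sorted_eigenvalues (S (?Z \<omega>)) ! i) \<in> borel_measurable M"
  proof (rule measurable_if_dist_le_sum[where Z = ?Z and K = "{..<n} \<times> {..<n}"
      and G = "\<lambda>e. sorted_eigenvalues (S e) ! i"])
    fix e e' :: "nat \<times> nat \<Rightarrow> real"
    let ?d = "\<lambda>a b. \<bar>e (a, b) - e' (a, b)\<bar>"
    have "(\<Sum>a<n. \<Sum>b<n. \<bar>(S e - S e') $$ (a, b)\<bar>) \<le> (\<Sum>a<n. \<Sum>b<n. ?d a b / 2 + ?d b a / 2)"
      by (intro sum_mono) (auto simp: S_def abs_if field_simps)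
    also have "\<dots> = (\<Sum>a<n. \<Sum>b<n. ?d a b / 2) + (\<Sum>a<n. \<Sum>b<n. ?d b a / 2)"
      by (simp add: sum.distrib)
    also have "(\<Sum>a<n. \<Sum>b<n. ?d b a / 2) = (\<Sum>a<n. \<Sum>b<n. ?d a b / 2)"
      by (rule sum.swap)
    also have "(\<Sum>a<n. \<Sum>b<n. ?d a b / 2) + (\<Sum>a<n. \<Sum>b<n. ?d a b / 2) = (\<Sum>a<n. \<Sum>b<n. ?d a b)"
      by (simp add: sum.distrib[symmetric])
    also have "\<dots> = (\<Sum>k\<in>{..<n} \<times> {..<n}. \<bar>e k - e' k\<bar>)"
      by (simp add: sum.cartesian_product)
    finally have d: "(\<Sum>a<n. \<Sum>b<n. \<bar>(S e - S e') $$ (a, b)\<bar>) \<le> (\<Sum>k\<in>{..<n} \<times> {..<n}. \<bar>e k - e' k\<bar>)" .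
    show "\<bar>sorted_eigenvalues (S e) ! i - sorted_eigenvalues (S e') ! i\<bar>
        \<le> (\<Sum>k\<in>{..<n} \<times> {..<n}. \<bar>e k - e' k\<bar>)"
    proof (rule sorted_eigenvalues_dist_le[OF S S _ i])
      fix x :: "real vec" assume x: "x \<in> carrier_vec n"
      have "x \<bullet> x \<ge> 0" using x by (simp add: scalar_prod_def sum_nonneg)
      have "S e - S e' \<in> carrier_mat n n" by (rule minus_carrier_mat[OF S(1)])
      note quadratic_form_le_sum_abs[OF this x]
      also have "(\<Sum>a<n. \<Sum>b<n. \<bar>(S e - S e') $$ (a, b)\<bar>) * (x \<bullet> x)
          \<le> (\<Sum>k\<in>{..<n} \<times> {..<n}. \<bar>e k - e' k\<bar>) * (x \<bullet> x)"
        by (rule mult_right_mono[OF d]) fact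
      finally show "\<bar>x \<bullet> ((S e - S e') *\<^sub>v x)\<bar> \<le> (\<Sum>k\<in>{..<n} \<times> {..<n}. \<bar>e k - e' k\<bar>) * (x \<bullet> x)" .
    qed
  next
    fix p :: "nat \<times> nat"
    show "(\<lambda>\<omega>. ?Z \<omega> p) \<in> borel_measurable M"
      using meas by (cases "fst p < n \<and> snd p < n"; cases p) auto
  qed
  moreover have "S (?Z \<omega>) = C \<omega>" if \<omega>: "\<omega> \<in> space M" for \<omega>
  proof (rule eq_matI)
    fix a b assume ab: "a < dim_row (C \<omega>)" "b < dim_col (C \<omega>)"
    hence "C \<omega> $$ (b, a) = C \<omega> $$ (a, b)"
      using sym[OF \<omega>] by (metis index_transpose_mat(1))
    thus "S (?Z \<omega>) $$ (a, b) = C \<omega> $$ (a, b)" using ab C[OF \<omega>] by (simp add: S_def)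
  qed (use C[OF \<omega>] in \<open>auto simp: S_def\<close>)
  ultimately show ?thesis by (simp cong: measurable_cong)
qed

subsection \<open>The sampled graph\<close>

lemma latent_measurable:
  assumes "prob_space M" "iid_uniform M N U" "i < N"
  shows "latent N U i \<in> borel_measurable M"
proof -
  have "prob_space.indep_vars M (\<lambda>_. borel) U {..<N}"
    using assms(2) unfolding iid_uniform_def by simp
  hence "U j \<in> borel_measurable M" if "j < N" for j
    using that unfolding prob_space.indep_vars_def2[OF assms(1)] by simp
  thus ?thesis unfolding latent_def using assms(3) by (intro measurable_sort_nth)
qed

lemma latent_range:
  assumes "iid_uniform M N U" "i < N" "\<omega> \<in> space M"
  shows "latent N U i \<omega> \<in> {0..1}"
proof -
  have "latent N U i \<omega> \<in> set (sort (map (\<lambda>j. U j \<omega>) [0..<N]))"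
    unfolding latent_def by (rule nth_mem) (use assms in simp)
  thus ?thesis using assms unfolding iid_uniform_def by auto
qed

lemma laplacian_carrier: "A \<in> carrier_mat n n \<Longrightarrow> laplacian A \<in> carrier_mat n n"
  unfolding laplacian_def by (rule minus_carrier_mat) simp

lemma laplacian_index:
  assumes "A \<in> carrier_mat n n" "i < n" "j < n"
  shows "laplacian A $$ (i, j) = (if i = j then degree_of A i else 0) - A $$ (i, j)"
  using assms unfolding laplacian_def by (auto simp: mat_diag_def)

lemma laplacian_symmetric:
  assumes "A \<in> carrier_mat n n" "transpose_mat A = A"
  shows "transpose_mat (laplacian A) = laplacian A"
proof (rule eq_matI)
  note L = laplacian_carrier[OF assms(1)]
  fix i j assume ij: "i < dim_row (laplacian A)" "j < dim_col (laplacian A)"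
  hence "i < n" "j < n" using L by auto
  moreover from this have "A $$ (i, j) = A $$ (j, i)"
    using assms by (metis carrier_matD index_transpose_mat(1))
  ultimately show "transpose_mat (laplacian A) $$ (i, j) = laplacian A $$ (i, j)"
    using L laplacian_index[OF assms(1)] by auto
qed (use laplacian_carrier[OF assms(1)] in auto)

lemma laplacian_diff_quadratic_form:
  fixes A B :: "real mat"
  assumes A: "A \<in> carrier_mat n n" and B: "B \<in> carrier_mat n n" and x: "x \<in> carrier_vec n"
  shows "x \<bullet> ((laplacian A - laplacian B) *\<^sub>v x)
    = (\<Sum>i<n. (degree_of A i - degree_of B i) * (x $ i)\<^sup>2) - x \<bullet> ((A - B) *\<^sub>v x)"
proof -
  have c: "laplacian A - laplacian B \<in> carrier_mat n n" "A - B \<in> carrier_mat n n"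
    using minus_carrier_mat[OF laplacian_carrier[OF B]] minus_carrier_mat[OF B] by auto
  have "x \<bullet> ((laplacian A - laplacian B) *\<^sub>v x) = (\<Sum>i<n. \<Sum>j<n.
      (if i = j then (degree_of A i - degree_of B i) * (x $ i)\<^sup>2 else 0) - x $ i * x $ j * (A - B) $$ (i, j))"
    unfolding quadratic_form_eq_sum[OF c(1) x]
    using A B laplacian_carrier[OF A] laplacian_carrier[OF B]
    by (intro sum.cong refl) (auto simp: laplacian_index algebra_simps power2_eq_square)
  thus ?thesis
    unfolding quadratic_form_eq_sum[OF c(2) x] by (simp add: sum_subtractf)
qed

locale sampled_graph = prob_space M
  for M :: "'a measure" +
  fixes W :: "real \<Rightarrow> real \<Rightarrow> real" and N :: nat and X :: "nat \<Rightarrow> 'a \<Rightarrow> real"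
    and A Abar :: "'a \<Rightarrow> real mat"
  assumes graphon: "graphon W"
    and X_measurable: "\<And>i. i < N \<Longrightarrow> X i \<in> borel_measurable M"
    and X_range: "\<And>i \<omega>. i < N \<Longrightarrow> \<omega> \<in> space M \<Longrightarrow> X i \<omega> \<in> {0..1}"
    and Abar_def: "Abar = weighted_adjacency W N X"
    and random: "random_adjacency M W N X A"
begin

abbreviation F where "F \<equiv> generated_algebra M N X"

abbreviation pairs where "pairs \<equiv> {(i, j). i \<le> j \<and> j < N}"

lemma A_carrier: "\<omega> \<in> space M \<Longrightarrow> A \<omega> \<in> carrier_mat N N"
  and A_symmetric: "\<omega> \<in> space M \<Longrightarrow> transpose_mat (A \<omega>) = A \<omega>"
  using random unfolding random_adjacency_def by auto

lemma A_index_symmetric: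
  "\<omega> \<in> space M \<Longrightarrow> a < N \<Longrightarrow> b < N \<Longrightarrow> A \<omega> $$ (a, b) = A \<omega> $$ (b, a)"
  by (metis A_carrier A_symmetric carrier_matD index_transpose_mat(1))

lemma Abar_carrier: "Abar \<omega> \<in> carrier_mat N N"
  unfolding Abar_def weighted_adjacency_def by simp

lemma Abar_index: "a < N \<Longrightarrow> b < N \<Longrightarrow> Abar \<omega> $$ (a, b) = W (X a \<omega>) (X b \<omega>)"
  unfolding Abar_def weighted_adjacency_def by simp

lemma W_latent:
  assumes "a < N" "b < N" "\<omega> \<in> space M"
  shows "W (X a \<omega>) (X b \<omega>) \<in> {0..1}" "W (X a \<omega>) (X b \<omega>) = W (X b \<omega>) (X a \<omega>)"
  using graphon X_range assms unfolding graphon_def by blast+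

lemma Abar_symmetric:
  assumes "\<omega> \<in> space M"
  shows "transpose_mat (Abar \<omega>) = Abar \<omega>"
  using Abar_carrier[of \<omega>] by (intro eq_matI) (auto simp: Abar_index W_latent(2)[OF _ _ assms])

lemma subalgebra_F: "subalgebra M F"
proof -
  have m: "(\<lambda>\<omega>. \<lambda>i\<in>{..<N}. X i \<omega>) \<in> measurable M (\<Pi>\<^sub>M i\<in>{..<N}. borel)"
    using X_measurable by (intro measurable_restrict) auto
  hence "sets F = {(\<lambda>\<omega>. \<lambda>i\<in>{..<N}. X i \<omega>) -` B \<inter> space M |B. B \<in> sets (\<Pi>\<^sub>M i\<in>{..<N}. borel)}"
    unfolding generated_algebra_def
    by (intro sets_vimage_algebra2) (auto dest: measurable_space)
  thus ?thesis
    using m unfolding subalgebra_def by (auto simp: generated_algebra_def measurable_sets)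
qed

lemma X_measurable_F:
  assumes "i < N"
  shows "X i \<in> borel_measurable F"
proof -
  have "(\<lambda>\<omega>. \<lambda>i\<in>{..<N}. X i \<omega>) \<in> measurable F (\<Pi>\<^sub>M i\<in>{..<N}. borel)"
    unfolding generated_algebra_def
    by (rule measurable_vimage_algebra1) (auto simp: space_PiM)
  from measurable_compose[OF this measurable_component_singleton, of i]
  show ?thesis using assms by simp
qed

text \<open>W is controlled on the unit square only, so the pair of latent variables is viewed as a
  map into the restricted space, which \<open>X_range\<close> permits at every outcome.\<close>

lemma W_latent_measurable_F:
  assumes "a < N" "b < N"
  shows "(\<lambda>\<omega>. W (X a \<omega>) (X b \<omega>)) \<in> borel_measurable F"
proof -
  have space: "space F = space M" using subalgebra_F unfolding subalgebra_def by simp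
  have "(\<lambda>\<omega>. (X a \<omega>, X b \<omega>)) \<in> measurable F (restrict_space borel ({0..1} \<times> {0..1}))"
    using X_range assms
    by (intro measurable_restrict_space2 borel_measurable_Pair X_measurable_F) (auto simp: space)
  moreover have "case_prod W \<in> borel_measurable (restrict_space borel ({0..1} \<times> {0..1}))"
    using graphon unfolding graphon_def by simp
  ultimately have "(\<lambda>\<omega>. case_prod W (X a \<omega>, X b \<omega>)) \<in> borel_measurable F"
    by (rule measurable_compose)
  thus ?thesis by simp
qed

sublocale bernoulli: conditional_bernoulli_family M F
  "\<lambda>(i, j) \<omega>. A \<omega> $$ (i, j)" "\<lambda>(i, j) \<omega>. W (X i \<omega>) (X j \<omega>)" pairs
proof unfold_locales
  show "subalgebra M F" by (rule subalgebra_F)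
  show "finite pairs" by (rule finite_upper_triangle)
  show "cond_indep_vars M F (\<lambda>(i, j) \<omega>. A \<omega> $$ (i, j)) pairs"
    using random unfolding random_adjacency_def by simp
  fix k assume k: "k \<in> pairs"
  then obtain i j where ij: "k = (i, j)" "i \<le> j" "j < N" by auto
  show "cond_bernoulli M F ((\<lambda>(i, j) \<omega>. A \<omega> $$ (i, j)) k) ((\<lambda>(i, j) \<omega>. W (X i \<omega>) (X j \<omega>)) k)"
    using random ij unfolding random_adjacency_def by simp
  show "((\<lambda>(i, j) \<omega>. W (X i \<omega>) (X j \<omega>)) k) \<in> borel_measurable F"
    using ij W_latent_measurable_F by simp
  fix \<omega> assume "\<omega> \<in> space M"
  thus "(\<lambda>(i, j) \<omega>. W (X i \<omega>) (X j \<omega>)) k \<omega> \<in> {0..1}"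
    using ij W_latent by simp
qed

lemma A_measurable:
  assumes "a < N" "b < N"
  shows "(\<lambda>\<omega>. A \<omega> $$ (a, b)) \<in> borel_measurable M"
proof (cases "a \<le> b")
  case True
  thus ?thesis using bernoulli.Y_measurable[of "(a, b)"] assms by simp
next
  case False
  hence "(\<lambda>\<omega>. A \<omega> $$ (b, a)) \<in> borel_measurable M"
    using bernoulli.Y_measurable[of "(b, a)"] assms by simp
  thus ?thesis using A_index_symmetric assms by (simp cong: measurable_cong)
qed

lemma Abar_measurable_F:
  assumes "a < N" "b < N"
  shows "(\<lambda>\<omega>. Abar \<omega> $$ (a, b)) \<in> borel_measurable F"
  using W_latent_measurable_F[OF assms] Abar_index[OF assms] by simp

lemma Abar_measurable:
  assumes "a < N" "b < N"
  shows "(\<lambda>\<omega>. Abar \<omega> $$ (a, b)) \<in> borel_measurable M"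
  using measurable_from_subalg[OF subalgebra_F Abar_measurable_F[OF assms]] .

lemma degree_eq:
  assumes "C \<in> carrier_mat N N"
  shows "degree_of C i = (\<Sum>j<N. C $$ (i, j))"
  using assms unfolding degree_of_def by simp

lemma degree_measurable:
  assumes "i < N"
  shows "(\<lambda>\<omega>. degree_of (A \<omega>) i) \<in> borel_measurable M"
    and "(\<lambda>\<omega>. degree_of (Abar \<omega>) i) \<in> borel_measurable F"
    and "(\<lambda>\<omega>. degree_of (Abar \<omega>) i) \<in> borel_measurable M"
proof -
  have "(\<lambda>\<omega>. \<Sum>j<N. A \<omega> $$ (i, j)) \<in> borel_measurable M"
    using A_measurable assms by (intro borel_measurable_sum) auto
  thus "(\<lambda>\<omega>. degree_of (A \<omega>) i) \<in> borel_measurable M"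
    using degree_eq A_carrier by (simp cong: measurable_cong)
  show F: "(\<lambda>\<omega>. degree_of (Abar \<omega>) i) \<in> borel_measurable F"
    unfolding degree_eq[OF Abar_carrier] using Abar_measurable_F assms
    by (intro borel_measurable_sum) auto
  show "(\<lambda>\<omega>. degree_of (Abar \<omega>) i) \<in> borel_measurable M"
    using measurable_from_subalg[OF subalgebra_F F] .
qed

lemma normalized_degree_eq:
  assumes "C \<in> carrier_mat N N"
  shows "normalized_degree C i = sort (map (degree_of C) [0..<N]) ! i / real N"
  using assms unfolding normalized_degree_def sorted_degrees_def by simp

lemma normalized_degree_measurable:
  assumes "i < N"
  shows "(\<lambda>\<omega>. normalized_degree (A \<omega>) i) \<in> borel_measurable M"
    and "(\<lambda>\<omega>. normalized_degree (Abar \<omega>) i) \<in> borel_measurable M"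
proof -
  have "(\<lambda>\<omega>. sort (map (\<lambda>j. degree_of (A \<omega>) j) [0..<N]) ! i / real N) \<in> borel_measurable M"
    by (intro borel_measurable_divide measurable_sort_nth degree_measurable assms) auto
  thus "(\<lambda>\<omega>. normalized_degree (A \<omega>) i) \<in> borel_measurable M"
    using normalized_degree_eq A_carrier by (simp cong: measurable_cong)
  have "(\<lambda>\<omega>. sort (map (\<lambda>j. degree_of (Abar \<omega>) j) [0..<N]) ! i / real N) \<in> borel_measurable M"
    by (intro borel_measurable_divide measurable_sort_nth degree_measurable assms) auto
  thus "(\<lambda>\<omega>. normalized_degree (Abar \<omega>) i) \<in> borel_measurable M"
    unfolding normalized_degree_eq[OF Abar_carrier] by simp
qed

text \<open>The conditioning event of the theorem is determined by the latent variables; this lets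
  it serve as \<open>E\<close> in the bounds below.\<close>

lemma max_degree_event:
  assumes "N \<ge> 1"
  shows "{\<omega> \<in> space M. sorted_degrees (Abar \<omega>) ! (N - 1) > c} \<in> sets F"
proof -
  have [measurable]: "(\<lambda>\<omega>. sorted_degrees (Abar \<omega>) ! (N - 1)) \<in> borel_measurable F"
    using Abar_carrier assms unfolding sorted_degrees_def
    by (simp add: carrier_matD[OF Abar_carrier] measurable_sort_nth degree_measurable(2))
  have "{\<omega> \<in> space F. sorted_degrees (Abar \<omega>) ! (N - 1) > c} \<in> sets F" by measurable
  thus ?thesis by (simp add: bernoulli.space_F)
qed

text \<open>Kept general in C so that it serves both Laplacians.\<close>

lemma laplacian_eigenvalue_measurable:
  assumes C: "\<And>\<omega>. \<omega> \<in> space M \<Longrightarrow> C \<omega> \<in> carrier_mat N N"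
    and sym: "\<And>\<omega>. \<omega> \<in> space M \<Longrightarrow> transpose_mat (C \<omega>) = C \<omega>"
    and meas: "\<And>a b. a < N \<Longrightarrow> b < N \<Longrightarrow> (\<lambda>\<omega>. C \<omega> $$ (a, b)) \<in> borel_measurable M"
    and deg: "\<And>a. a < N \<Longrightarrow> (\<lambda>\<omega>. degree_of (C \<omega>) a) \<in> borel_measurable M"
    and i: "i < N"
  shows "(\<lambda>\<omega>. normalized_laplacian_eigenvalue (C \<omega>) i) \<in> borel_measurable M"
proof -
  have "(\<lambda>\<omega>. laplacian (C \<omega>) $$ (a, b)) \<in> borel_measurable M" if ab: "a < N" "b < N" for a b
  proof -
    have "(\<lambda>\<omega>. (if a = b then degree_of (C \<omega>) a else 0) - C \<omega> $$ (a, b)) \<in> borel_measurable M"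
      using meas[OF ab] deg[OF ab(1)] by (cases "a = b") auto
    thus ?thesis using laplacian_index[OF C ab] by (simp cong: measurable_cong)
  qed
  hence "(\<lambda>\<omega>. sorted_eigenvalues (laplacian (C \<omega>)) ! i) \<in> borel_measurable M"
    using C sym i by (intro measurable_sorted_eigenvalues laplacian_carrier laplacian_symmetric)
  hence "(\<lambda>\<omega>. sorted_eigenvalues (laplacian (C \<omega>)) ! i / real N) \<in> borel_measurable M"
    by simp
  thus ?thesis
    using C unfolding normalized_laplacian_eigenvalue_def
    by (simp add: carrier_matD[OF C] cong: measurable_cong)
qed

text \<open>The applied case expressions repeat the shape in which the sublocale instantiates its
  two families, so that \<open>conditional_Hoeffding\<close> matches.\<close>

lemma deviation_eq:
  assumes \<omega>: "\<omega> \<in> space M"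
  shows "(\<Sum>a<N. \<Sum>b<N. f a b * (A \<omega> - Abar \<omega>) $$ (a, b))
    = (\<Sum>k\<in>pairs. (case k of (a, b) \<Rightarrow> if a = b then f a a else f a b + f b a) *
        ((case k of (i, j) \<Rightarrow> \<lambda>\<omega>. A \<omega> $$ (i, j)) \<omega> - (case k of (i, j) \<Rightarrow> \<lambda>\<omega>. W (X i \<omega>) (X j \<omega>)) \<omega>))"
proof -
  have "(\<Sum>a<N. \<Sum>b<N. f a b * (A \<omega> - Abar \<omega>) $$ (a, b))
      = (\<Sum>a<N. \<Sum>b<N. f a b * (A \<omega> $$ (a, b) - W (X a \<omega>) (X b \<omega>)))"
    using Abar_carrier[of \<omega>] by (intro sum.cong refl) (simp add: Abar_index)
  also have "\<dots> = (\<Sum>(a, b)\<in>pairs. (if a = b then f a a else f a b + f b a) * (A \<omega> $$ (a, b) - W (X a \<omega>) (X b \<omega>)))"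
    by (rule sum_symmetric_upper_triangle) (simp add: A_index_symmetric[OF \<omega>] W_latent[OF _ _ \<omega>])
  finally show ?thesis by (simp add: case_prod_unfold)
qed

text \<open>The squares of the folded coefficients sum to at most 2 V, which turns the Hoeffding
  exponent into - 2 t^2 / (2 V).\<close>

lemma deviation_bound:
  assumes E: "E \<in> sets F" and V: "(\<Sum>a<N. \<Sum>b<N. (f a b)\<^sup>2) \<le> V" "V > 0" and t: "t \<ge> 0"
  shows "{\<omega> \<in> E. t \<le> \<bar>\<Sum>a<N. \<Sum>b<N. f a b * (A \<omega> - Abar \<omega>) $$ (a, b)\<bar>} \<in> sets M"
    and "prob {\<omega> \<in> E. t \<le> \<bar>\<Sum>a<N. \<Sum>b<N. f a b * (A \<omega> - Abar \<omega>) $$ (a, b)\<bar>}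
      \<le> 2 * exp (- t\<^sup>2 / V) * prob E"
proof -
  define c where "c k = (case k of (a, b) \<Rightarrow> if a = b then f a a else f a b + f b a)" for k
  have c: "(\<Sum>k\<in>pairs. (c k)\<^sup>2) \<le> 2 * V" "2 * V > 0"
    using sum_upper_triangle_square_le[of f N] V by (auto simp: c_def case_prod_unfold)
  have "E \<subseteq> space M"
    using sets.sets_into_space[OF bernoulli.sets_F[OF E]] .
  hence eq: "{\<omega> \<in> E. t \<le> \<bar>\<Sum>a<N. \<Sum>b<N. f a b * (A \<omega> - Abar \<omega>) $$ (a, b)\<bar>}
    = {\<omega> \<in> E. t \<le> \<bar>\<Sum>k\<in>pairs. c k * ((case k of (i, j) \<Rightarrow> \<lambda>\<omega>. A \<omega> $$ (i, j)) \<omega> -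
        (case k of (i, j) \<Rightarrow> \<lambda>\<omega>. W (X i \<omega>) (X j \<omega>)) \<omega>)\<bar>}"
    unfolding c_def by (auto simp: deviation_eq subset_eq)
  note H = bernoulli.conditional_Hoeffding[OF E c t]
  show "{\<omega> \<in> E. t \<le> \<bar>\<Sum>a<N. \<Sum>b<N. f a b * (A \<omega> - Abar \<omega>) $$ (a, b)\<bar>} \<in> sets M"
    unfolding eq by (rule H(1))
  show "prob {\<omega> \<in> E. t \<le> \<bar>\<Sum>a<N. \<Sum>b<N. f a b * (A \<omega> - Abar \<omega>) $$ (a, b)\<bar>}
      \<le> 2 * exp (- t\<^sup>2 / V) * prob E"
    unfolding eq using H(2) by simp
qed

end

section \<open>Deviation of degrees, adjacency matrices and Laplacian spectra\<close>

context sampled_graph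
begin

text \<open>The exceptional set itself is returned, so that it can later be united with that of
  \<open>adjacency_deviation\<close>.\<close>

lemma degree_deviation:
  assumes N: "N \<ge> 1" and nu: "0 < \<nu>" "\<nu> < 1" and E: "E \<in> sets F"
  defines "L \<equiv> ln (2 * real N / \<nu>)"
  obtains B where "B \<in> sets M" "prob B \<le> \<nu> * prob E"
    "\<And>\<omega> i. \<omega> \<in> E - B \<Longrightarrow> i < N \<Longrightarrow> \<bar>degree_of (A \<omega>) i - degree_of (Abar \<omega>) i\<bar> < sqrt (real N * L)"
proof -
  have EM: "E \<subseteq> space M" using sets.sets_into_space[OF bernoulli.sets_F[OF E]] .
  have "2 * real N / \<nu> \<ge> 1" using N nu by (simp add: field_simps)
  hence L: "L \<ge> 0" unfolding L_def by simp
  have expL: "exp (- L) = \<nu> / (2 * real N)"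
    unfolding L_def using N nu by (simp add: exp_minus)
  \<comment> \<open>With V = N this makes t^2 / V = L, so each of the N rows fails with probability
    at most \<nu> / N times \<open>prob E\<close>.\<close>
  define t where "t = sqrt (real N * L)"
  \<comment> \<open>Selects row i, so the linear form is the deviation of one degree; its N unit
    coefficients give V = N.\<close>
  define f :: "nat \<Rightarrow> nat \<Rightarrow> nat \<Rightarrow> real" where "f i a b = (if a = i then 1 else 0)" for i a b
  define B where
    "B i = {\<omega> \<in> E. t \<le> \<bar>\<Sum>a<N. \<Sum>b<N. f i a b * (A \<omega> - Abar \<omega>) $$ (a, b)\<bar>}" for i
  have V: "(\<Sum>a<N. \<Sum>b<N. (f i a b)\<^sup>2) \<le> real N" if "i < N" for i
  proof -
    have "(\<Sum>b<N. (f i a b)\<^sup>2) = (if a = i then real N else 0)" for a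
      by (simp add: f_def)
    thus ?thesis using that by simp
  qed
  have t: "t \<ge> 0" unfolding t_def using L by simp
  have N0: "real N > 0" using N by simp
  have B: "B i \<in> sets M" "prob (B i) \<le> \<nu> / real N * prob E" if "i < N" for i
  proof -
    note dev = deviation_bound[OF E V[OF that] N0 t, folded B_def]
    show "B i \<in> sets M" by (rule dev)
    have "t\<^sup>2 / real N = L" unfolding t_def using L N0 by simp
    hence "2 * exp (- t\<^sup>2 / real N) = \<nu> / real N" using expL by simp
    thus "prob (B i) \<le> \<nu> / real N * prob E" using dev(2) by simp
  qed
  show ?thesis
  proof (rule that[of "\<Union>i<N. B i"])
    show "(\<Union>i<N. B i) \<in> sets M" using B by auto
    have "prob (\<Union>i<N. B i) \<le> (\<Sum>i<N. prob (B i))"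
      by (rule finite_measure_subadditive_finite) (use B in auto)
    also have "\<dots> \<le> (\<Sum>i<N. \<nu> / real N * prob E)"
      using B by (intro sum_mono) auto
    also have "\<dots> = \<nu> * prob E" using N0 by simp
    finally show "prob (\<Union>i<N. B i) \<le> \<nu> * prob E" .
    fix \<omega> i assume \<omega>: "\<omega> \<in> E - (\<Union>i<N. B i)" and i: "i < N"
    have \<omega>M: "\<omega> \<in> space M" using \<omega> EM by auto
    have "(\<Sum>a<N. \<Sum>b<N. f i a b * (A \<omega> - Abar \<omega>) $$ (a, b))
        = (\<Sum>a<N. if a = i then \<Sum>b<N. (A \<omega> - Abar \<omega>) $$ (a, b) else 0)"
      by (intro sum.cong refl) (simp add: f_def)
    also have "\<dots> = (\<Sum>b<N. (A \<omega> - Abar \<omega>) $$ (i, b))" using i by simp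
    also have "\<dots> = degree_of (A \<omega>) i - degree_of (Abar \<omega>) i"
      using i A_carrier[OF \<omega>M] Abar_carrier[of \<omega>]
      by (simp add: degree_eq sum_subtractf)
    finally have dev: "(\<Sum>a<N. \<Sum>b<N. f i a b * (A \<omega> - Abar \<omega>) $$ (a, b))
        = degree_of (A \<omega>) i - degree_of (Abar \<omega>) i" .
    have "\<omega> \<notin> B i" using \<omega> i by blast
    thus "\<bar>degree_of (A \<omega>) i - degree_of (Abar \<omega>) i\<bar> < sqrt (real N * L)"
      using \<omega> by (simp add: B_def dev t_def)
  qed
qed

text \<open>After lowering 9 / 4 to 2, each grid coordinate contributes the factor (4 n + 1) (\<nu>
  / (2 n))^2, at most 9 / 16 \<nu> for n \<ge> 2. Two such factors already absorb the leading 2, as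
  2 (9 / 16)^2 = 81 / 128.\<close>

lemma grid_union_bound:
  fixes \<nu> :: real
  assumes N: "n \<ge> 2" and nu: "0 < \<nu>" "\<nu> < 1"
  defines "L \<equiv> ln (2 * real n / \<nu>)"
  shows "real ((4 * n + 1) ^ n) * (2 * exp (- (9 / 4 * (real n * L)))) \<le> \<nu>"
proof -
  have n2: "real n \<ge> 2" using N by simp
  have "2 * real n / \<nu> \<ge> 1" using N nu by (simp add: field_simps)
  hence L: "L \<ge> 0" unfolding L_def by simp
  have expL: "exp (- L) = \<nu> / (2 * real n)"
    unfolding L_def using N nu by (simp add: exp_minus)
  have "exp (- (9 / 4 * (real n * L))) \<le> exp (real n * (- 2 * L))"
    using L by (simp add: mult_nonneg_nonneg)
  also have "\<dots> = (exp (- L) ^ 2) ^ n"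
    by (simp add: exp_of_nat_mult[symmetric])
  also have "\<dots> = ((\<nu> / (2 * real n)) ^ 2) ^ n" unfolding expL ..
  finally have "real ((4 * n + 1) ^ n) * (2 * exp (- (9 / 4 * (real n * L))))
      \<le> real ((4 * n + 1) ^ n) * (2 * ((\<nu> / (2 * real n)) ^ 2) ^ n)"
    by (intro mult_left_mono) auto
  also have "\<dots> = 2 * ((4 * real n + 1) / (4 * (real n)\<^sup>2) * \<nu>\<^sup>2) ^ n"
    by (simp add: power_mult_distrib power_divide power2_eq_square add.commute)
  \<comment> \<open>9 / 16 is the value of the fraction at n = 2.\<close>
  also have "(4 * real n + 1) / (4 * (real n)\<^sup>2) * \<nu>\<^sup>2 \<le> 9 / 16 * \<nu>"
  proof (intro mult_mono)
    have "64 * real n + 16 \<le> 36 * (2 * real n)" using n2 by simp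
    also have "\<dots> \<le> 36 * (real n * real n)" using n2 by (intro mult_left_mono mult_right_mono) auto
    finally show "(4 * real n + 1) / (4 * (real n)\<^sup>2) \<le> 9 / 16"
      using n2 by (simp add: field_simps power2_eq_square)
    show "\<nu>\<^sup>2 \<le> \<nu>" using nu by (simp add: power2_eq_square mult_left_le)
  qed auto
  hence "2 * ((4 * real n + 1) / (4 * (real n)\<^sup>2) * \<nu>\<^sup>2) ^ n \<le> 2 * (9 / 16 * \<nu>) ^ n"
    by (intro mult_left_mono power_mono) auto
  also have "(9 / 16 * \<nu>) ^ n \<le> (9 / 16 * \<nu>) ^ 2"
    using nu N by (intro power_decreasing) auto
  also have "2 * (9 / 16 * \<nu>)\<^sup>2 = 81 / 128 * \<nu> * \<nu>" by (simp add: power2_eq_square)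
  also have "\<dots> \<le> \<nu>" using nu mult_left_le[of \<nu> \<nu>] by simp
  finally show ?thesis by simp
qed

lemma adjacency_deviation:
  assumes N: "N \<ge> 2" and nu: "0 < \<nu>" "\<nu> < 1" and E: "E \<in> sets F"
  defines "L \<equiv> ln (2 * real N / \<nu>)"
  obtains B where "B \<in> sets M" "prob B \<le> \<nu> * prob E"
    "\<And>\<omega> x. \<omega> \<in> E - B \<Longrightarrow> x \<in> carrier_vec N \<Longrightarrow>
      \<bar>x \<bullet> ((A \<omega> - Abar \<omega>) *\<^sub>v x)\<bar> \<le> 2 * sqrt (real N * L) * (x \<bullet> x)"
proof -
  have EM: "E \<subseteq> space M" using sets.sets_into_space[OF bernoulli.sets_F[OF E]] .
  have "2 * real N / \<nu> > 1" using N nu by (simp add: field_simps)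
  hence L: "L > 0" unfolding L_def by simp
  \<comment> \<open>Each coordinate takes 4 N + 1 values; extensional functions make the preimage
    set finite and easy to count.\<close>
  define grid where "grid = (\<lambda>k. vec N (\<lambda>i. of_int (k i) / (2 * real N))) `
    (\<Pi>\<^sub>E i\<in>{..<N}. {- 2 * int N..2 * int N})"
  \<comment> \<open>The factor 3 / 2 is 3 / 4 of the target 2, as
    \<open>quadratic_form_bound_from_grid\<close> asks.\<close>
  define B where "B y = {\<omega> \<in> E. 3 / 2 * sqrt (real N * L) * (y \<bullet> y)
    \<le> \<bar>\<Sum>a<N. \<Sum>b<N. y $ a * y $ b * (A \<omega> - Abar \<omega>) $$ (a, b)\<bar>}" for y :: "real vec"
  \<comment> \<open>The lower bound on y \<bullet> y makes V = (y \<bullet> y)^2 positive in the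
    tail bound.\<close>
  let ?K = "{y \<in> grid. y \<bullet> y \<ge> 1 / 2}"
  have "finite (\<Pi>\<^sub>E i\<in>{..<N}. {- 2 * int N..2 * int N})" by (intro finite_PiE) auto
  hence fin: "finite grid" unfolding grid_def by simp
  have "card grid \<le> card (\<Pi>\<^sub>E i\<in>{..<N}. {- 2 * int N..2 * int N})"
    unfolding grid_def by (intro card_image_le finite_PiE) auto
  also have "\<dots> = (4 * N + 1) ^ N"
    by (simp add: card_PiE nat_add_distrib nat_mult_distrib)
  finally have card_grid: "card grid \<le> (4 * N + 1) ^ N" .
  have "card ?K \<le> card grid" by (rule card_mono[OF fin]) auto
  with card_grid have card: "card ?K \<le> (4 * N + 1) ^ N" by linarith
  have B: "B y \<in> sets M" "prob (B y) \<le> 2 * exp (- (9 / 4 * (real N * L))) * prob E" if y: "y \<in> ?K" for y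
  proof -
    have yc: "y \<in> carrier_vec N" using y unfolding grid_def by fastforce
    hence yy: "y \<bullet> y = (\<Sum>a<N. (y $ a)\<^sup>2)"
      by (simp add: scalar_prod_def lessThan_atLeast0 power2_eq_square)
    \<comment> \<open>The coefficients form a rank-one array, so V scales like the squared threshold
      and the length of y cancels in the exponent.\<close>
    have "(\<Sum>a<N. \<Sum>b<N. (y $ a * y $ b)\<^sup>2) = (y \<bullet> y)\<^sup>2"
      unfolding yy power2_eq_square[of "\<Sum>a<N. (y $ a)\<^sup>2"] sum_product
      by (simp add: power_mult_distrib)
    hence V: "(\<Sum>a<N. \<Sum>b<N. (y $ a * y $ b)\<^sup>2) \<le> (y \<bullet> y)\<^sup>2" by simp
    have yy_pos: "y \<bullet> y > 0" using y by simp
    hence V0: "(y \<bullet> y)\<^sup>2 > 0" by simp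
    have t: "3 / 2 * sqrt (real N * L) * (y \<bullet> y) \<ge> 0" using yy_pos L by simp
    note dev = deviation_bound[OF E V V0 t, folded B_def]
    show "B y \<in> sets M" by (rule dev)
    have "(3 / 2 * sqrt (real N * L) * (y \<bullet> y))\<^sup>2 / (y \<bullet> y)\<^sup>2 = 9 / 4 * (real N * L)"
      using yy_pos L by (simp add: power_mult_distrib power_divide)
    thus "prob (B y) \<le> 2 * exp (- (9 / 4 * (real N * L))) * prob E"
      using dev(2) by (simp only: minus_divide_left[symmetric])
  qed
  show ?thesis
  proof (rule that[of "\<Union>y\<in>?K. B y"])
    show "(\<Union>y\<in>?K. B y) \<in> sets M" using B fin by (intro sets.finite_UN) auto
    have "prob (\<Union>y\<in>?K. B y) \<le> (\<Sum>y\<in>?K. prob (B y))"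
      by (rule finite_measure_subadditive_finite) (use B fin in auto)
    also have "\<dots> \<le> (\<Sum>y\<in>?K. 2 * exp (- (9 / 4 * (real N * L))) * prob E)"
      using B by (intro sum_mono) auto
    also have "\<dots> = real (card ?K) * (2 * exp (- (9 / 4 * (real N * L)))) * prob E" by simp
    also have "\<dots> \<le> real ((4 * N + 1) ^ N) * (2 * exp (- (9 / 4 * (real N * L)))) * prob E"
      using card by (intro mult_right_mono) (auto simp del: of_nat_power)
    also have "\<dots> \<le> \<nu> * prob E"
      unfolding L_def by (rule mult_right_mono[OF grid_union_bound[OF N nu]]) simp
    finally show "prob (\<Union>y\<in>?K. B y) \<le> \<nu> * prob E" .
    fix \<omega> and x :: "real vec" assume \<omega>: "\<omega> \<in> E - (\<Union>y\<in>?K. B y)" and x: "x \<in> carrier_vec N"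
    have \<omega>M: "\<omega> \<in> space M" using \<omega> EM by auto
    have D: "A \<omega> - Abar \<omega> \<in> carrier_mat N N" by (rule minus_carrier_mat[OF Abar_carrier])
    have sym: "transpose_mat (A \<omega> - Abar \<omega>) = A \<omega> - Abar \<omega>"
      using transpose_minus[OF A_carrier[OF \<omega>M] Abar_carrier] A_symmetric[OF \<omega>M] Abar_symmetric[OF \<omega>M]
      by simp
    show "\<bar>x \<bullet> ((A \<omega> - Abar \<omega>) *\<^sub>v x)\<bar> \<le> 2 * sqrt (real N * L) * (x \<bullet> x)"
    proof (rule quadratic_form_bound_from_grid[OF D sym _ _ x])
      show "2 * sqrt (real N * L) > 0" using N L by simp
      fix k :: "nat \<Rightarrow> int" and y :: "real vec"
      assume k: "\<forall>i<N. \<bar>k i\<bar> \<le> 2 * int N" and y: "vec N (\<lambda>i. of_int (k i) / (2 * real N)) = y"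
        and yy: "y \<bullet> y \<ge> 1 / 2"
      \<comment> \<open>The given k is arbitrary from N on, while the grid comes from extensional
        functions; \<open>vec\<close> does not see the difference.\<close>
      have "y = vec N (\<lambda>i. of_int (restrict k {..<N} i) / (2 * real N))"
        unfolding y[symmetric] by (intro eq_vecI) auto
      moreover have "restrict k {..<N} \<in> (\<Pi>\<^sub>E i\<in>{..<N}. {- 2 * int N..2 * int N})"
        using k by (intro restrict_PiE_iff[THEN iffD2]) (simp add: abs_le_iff minus_le_iff)
      ultimately have "y \<in> grid" unfolding grid_def by (rule image_eqI)
      hence "\<omega> \<notin> B y" using \<omega> yy by auto
      moreover have "y \<in> carrier_vec N" using y by auto
      ultimately show "\<bar>y \<bullet> ((A \<omega> - Abar \<omega>) *\<^sub>v y)\<bar> < 3 / 4 * (2 * sqrt (real N * L)) * (y \<bullet> y)"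
        using \<omega> unfolding B_def quadratic_form_eq_sum[OF D \<open>y \<in> carrier_vec N\<close>] by auto
    qed
  qed
qed

lemma normalized_degree_deviation:
  assumes N: "N \<ge> 1" and \<omega>: "\<omega> \<in> space M" and i: "i < N"
    and deg: "\<And>j. j < N \<Longrightarrow> \<bar>degree_of (A \<omega>) j - degree_of (Abar \<omega>) j\<bar> < sqrt (real N * L)"
  shows "\<bar>normalized_degree (A \<omega>) i - normalized_degree (Abar \<omega>) i\<bar> \<le> sqrt (L / real N)"
proof -
  have "\<bar>sort (map (degree_of (A \<omega>)) [0..<N]) ! i - sort (map (degree_of (Abar \<omega>)) [0..<N]) ! i\<bar>
      \<le> sqrt (real N * L)"
    by (rule sort_nth_dist_le[OF _ i]) (use deg in \<open>auto intro: less_imp_le\<close>)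
  hence "\<bar>normalized_degree (A \<omega>) i - normalized_degree (Abar \<omega>) i\<bar> \<le> sqrt (real N * L) / real N"
    using N by (simp add: normalized_degree_eq[OF A_carrier[OF \<omega>]] normalized_degree_eq[OF Abar_carrier]
        diff_divide_distrib[symmetric] abs_divide divide_right_mono)
  also have "\<dots> = sqrt (L / real N)"
    using N by (simp add: real_sqrt_mult real_sqrt_divide field_simps)
  finally show ?thesis .
qed

lemma normalized_laplacian_deviation:
  assumes N: "N \<ge> 1" and \<omega>: "\<omega> \<in> space M" and i: "i < N"
    and deg: "\<And>j. j < N \<Longrightarrow> \<bar>degree_of (A \<omega>) j - degree_of (Abar \<omega>) j\<bar> < sqrt (real N * L)"
    and adj: "\<And>x. x \<in> carrier_vec N \<Longrightarrow>
      \<bar>x \<bullet> ((A \<omega> - Abar \<omega>) *\<^sub>v x)\<bar> \<le> 2 * sqrt (real N * L) * (x \<bullet> x)"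
  shows "\<bar>normalized_laplacian_eigenvalue (A \<omega>) i - normalized_laplacian_eigenvalue (Abar \<omega>) i\<bar>
    \<le> 3 * sqrt (L / real N)"
proof -
  note A = A_carrier[OF \<omega>] and Ab = Abar_carrier[of \<omega>]
  have "\<bar>sorted_eigenvalues (laplacian (A \<omega>)) ! i - sorted_eigenvalues (laplacian (Abar \<omega>)) ! i\<bar>
      \<le> 3 * sqrt (real N * L)"
  proof (rule sorted_eigenvalues_dist_le[OF laplacian_carrier[OF A] laplacian_symmetric[OF A A_symmetric[OF \<omega>]]
        laplacian_carrier[OF Ab] laplacian_symmetric[OF Ab Abar_symmetric[OF \<omega>]] _ i])
    fix x :: "real vec" assume x: "x \<in> carrier_vec N"
    have "\<bar>\<Sum>j<N. (degree_of (A \<omega>) j - degree_of (Abar \<omega>) j) * (x $ j)\<^sup>2\<bar>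
        \<le> (\<Sum>j<N. \<bar>(degree_of (A \<omega>) j - degree_of (Abar \<omega>) j) * (x $ j)\<^sup>2\<bar>)"
      by (rule sum_abs)
    also have "\<dots> \<le> (\<Sum>j<N. sqrt (real N * L) * (x $ j)\<^sup>2)"
      by (intro sum_mono) (auto simp: abs_mult intro!: mult_right_mono less_imp_le[OF deg])
    also have "\<dots> = sqrt (real N * L) * (x \<bullet> x)"
      using x by (simp add: scalar_prod_def lessThan_atLeast0 power2_eq_square sum_distrib_left)
    finally show "\<bar>x \<bullet> ((laplacian (A \<omega>) - laplacian (Abar \<omega>)) *\<^sub>v x)\<bar> \<le> 3 * sqrt (real N * L) * (x \<bullet> x)"
      using adj[OF x] unfolding laplacian_diff_quadratic_form[OF A Ab x] by linarith
  qed
  hence "\<bar>normalized_laplacian_eigenvalue (A \<omega>) i - normalized_laplacian_eigenvalue (Abar \<omega>) i\<bar>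
      \<le> 3 * sqrt (real N * L) / real N"
    using N A Ab unfolding normalized_laplacian_eigenvalue_def
    by (simp add: diff_divide_distrib[symmetric] abs_divide divide_right_mono)
  also have "\<dots> = 3 * sqrt (L / real N)"
    using N by (simp add: real_sqrt_mult real_sqrt_divide field_simps)
  finally show ?thesis .
qed

section \<open>Probabilities of the two events\<close>

lemma degree_event:
  assumes N: "N \<ge> 1" and nu: "0 < \<nu>" "\<nu> < 1"
  shows "\<P>(\<omega> in M.
        (MAX i\<in>{..<N}. \<bar>normalized_degree (A \<omega>) i - normalized_degree (Abar \<omega>) i\<bar>)
          \<le> sqrt (ln (2 * real N / \<nu>) / real N)) \<ge> 1 - \<nu>"
proof -
  let ?L = "ln (2 * real N / \<nu>)"
  have ne: "{..<N} \<noteq> {}" using N by (simp add: lessThan_empty_iff)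
  let ?G = "{\<omega> \<in> space M. \<forall>i\<in>{..<N}. \<bar>normalized_degree (A \<omega>) i - normalized_degree (Abar \<omega>) i\<bar>
      \<le> sqrt (?L / real N)}"
  \<comment> \<open>Taking the whole space as the event turns the relative bound into an absolute
    one.\<close>
  have "space M \<in> sets F" using sets.top[of F] by (simp add: bernoulli.space_F)
  from degree_deviation[OF N nu this] obtain B where B: "B \<in> sets M" "prob B \<le> \<nu> * prob (space M)"
    "\<And>\<omega> i. \<omega> \<in> space M - B \<Longrightarrow> i < N \<Longrightarrow>
        \<bar>degree_of (A \<omega>) i - degree_of (Abar \<omega>) i\<bar> < sqrt (real N * ?L)" by blast
  have G: "?G \<in> sets M"
  proof (rule sets.sets_Collect_finite_All)
    fix i assume "i \<in> {..<N}"
    hence i: "i < N" by simp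
    note [measurable] = normalized_degree_measurable[OF i]
    show "{\<omega> \<in> space M. \<bar>normalized_degree (A \<omega>) i - normalized_degree (Abar \<omega>) i\<bar>
        \<le> sqrt (?L / real N)} \<in> sets M" by measurable
  qed simp
  have "1 - \<nu> \<le> 1 - prob B" using B(2) by (simp add: prob_space)
  also have "\<dots> = prob (space M - B)" using prob_compl[OF B(1)] by simp
  also have "\<dots> \<le> prob ?G"
    using normalized_degree_deviation[OF N] B(3) by (intro finite_measure_mono G) auto
  finally show ?thesis using ne by (simp add: Max_le_iff image_iff)
qed

text \<open>Multiplied out by \<open>prob E\<close>, so that null events are covered and the
  division is left to the theorem.\<close>

lemma laplacian_event:
  assumes N: "N \<ge> 1" and nu: "0 < \<nu>" "\<nu> < 1" and E: "E \<in> sets F"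
  shows "(1 - 2 * \<nu>) * prob E \<le> prob {\<omega> \<in> E.
        (MAX i\<in>{..<N}. \<bar>normalized_laplacian_eigenvalue (A \<omega>) i
                          - normalized_laplacian_eigenvalue (Abar \<omega>) i\<bar>)
          \<le> 3 * sqrt (ln (2 * real N / \<nu>) / real N)}"
proof -
  let ?L = "ln (2 * real N / \<nu>)"
  have ne: "{..<N} \<noteq> {}" using N by (simp add: lessThan_empty_iff)
  have EM: "E \<in> sets M" using bernoulli.sets_F[OF E] .
  have Esub: "E \<subseteq> space M" using sets.sets_into_space[OF EM] .
  have "2 * real N / \<nu> \<ge> 1" using N nu by (simp add: field_simps)
  hence L: "?L \<ge> 0" by simp
  let ?good = "\<lambda>\<omega>. \<forall>i\<in>{..<N}. \<bar>normalized_laplacian_eigenvalue (A \<omega>) i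
      - normalized_laplacian_eigenvalue (Abar \<omega>) i\<bar> \<le> 3 * sqrt (?L / real N)"
  let ?G = "{\<omega> \<in> E. ?good \<omega>}"
  have "{\<omega> \<in> space M. ?good \<omega>} \<in> sets M"
  proof (rule sets.sets_Collect_finite_All)
    fix i assume "i \<in> {..<N}"
    hence i: "i < N" by simp
    note [measurable] =
      laplacian_eigenvalue_measurable[OF A_carrier A_symmetric A_measurable degree_measurable(1) i]
      laplacian_eigenvalue_measurable[OF Abar_carrier Abar_symmetric Abar_measurable
        degree_measurable(3) i]
    show "{\<omega> \<in> space M. \<bar>normalized_laplacian_eigenvalue (A \<omega>) i
        - normalized_laplacian_eigenvalue (Abar \<omega>) i\<bar> \<le> 3 * sqrt (?L / real N)} \<in> sets M"
      by measurable
  qed simp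
  moreover have "?G = E \<inter> {\<omega> \<in> space M. ?good \<omega>}" using Esub by auto
  ultimately have G: "?G \<in> sets M" using EM by (simp only: sets.Int)
  have "\<exists>C. C \<in> sets M \<and> prob C \<le> 2 * \<nu> * prob E \<and> (\<forall>\<omega>\<in>E - C. ?good \<omega>)"
  proof (cases "N = 1")
    case True
    \<comment> \<open>For N = 1 the grid count would fail when \<nu> is near 1. But a 1 x 1
      Laplacian is zero, so the eigenvalues agree and the empty exceptional set works.\<close>
    have "laplacian C = 0\<^sub>m 1 1" if "C \<in> carrier_mat 1 1" for C
    proof (rule eq_matI)
      fix i j assume "i < dim_row (0\<^sub>m 1 1 :: real mat)" "j < dim_col (0\<^sub>m 1 1 :: real mat)"
      thus "laplacian C $$ (i, j) = 0\<^sub>m 1 1 $$ (i, j)"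
        using laplacian_index[OF that, of 0 0] that by (simp add: degree_of_def)
    qed (use laplacian_carrier[OF that] in auto)
    hence "laplacian (A \<omega>) = laplacian (Abar \<omega>)" if "\<omega> \<in> E" for \<omega>
      using A_carrier[of \<omega>] Abar_carrier[of \<omega>] that Esub True by auto
    hence "?good \<omega>" if "\<omega> \<in> E" for \<omega>
      using that A_carrier[of \<omega>] Abar_carrier[of \<omega>] Esub True L
      unfolding normalized_laplacian_eigenvalue_def by auto
    thus ?thesis using nu by (intro exI[of _ "{}"]) auto
  next
    case False
    hence N2: "N \<ge> 2" using N by simp
    obtain B where B: "B \<in> sets M" "prob B \<le> \<nu> * prob E"
      "\<And>\<omega> i. \<omega> \<in> E - B \<Longrightarrow> i < N \<Longrightarrow> \<bar>degree_of (A \<omega>) i - degree_of (Abar \<omega>) i\<bar> < sqrt (real N * ?L)"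
      using degree_deviation[OF N nu E] by blast
    obtain C where C: "C \<in> sets M" "prob C \<le> \<nu> * prob E"
      "\<And>\<omega> x. \<omega> \<in> E - C \<Longrightarrow> x \<in> carrier_vec N \<Longrightarrow>
        \<bar>x \<bullet> ((A \<omega> - Abar \<omega>) *\<^sub>v x)\<bar> \<le> 2 * sqrt (real N * ?L) * (x \<bullet> x)"
      using adjacency_deviation[OF N2 nu E] by blast
    have "prob (B \<union> C) \<le> 2 * \<nu> * prob E"
      using measure_Un_le[OF B(1) C(1)] B(2) C(2) by simp
    moreover have "?good \<omega>" if "\<omega> \<in> E - (B \<union> C)" for \<omega>
      using normalized_laplacian_deviation[OF N, of \<omega>] B(3)[of \<omega>] C(3)[of \<omega>] that Esub by auto
    ultimately show ?thesis using B(1) C(1) by (intro exI[of _ "B \<union> C"]) auto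
  qed
  then obtain C where C: "C \<in> sets M" "prob C \<le> 2 * \<nu> * prob E" "\<forall>\<omega>\<in>E - C. ?good \<omega>" by blast
  have "prob E \<le> prob (?G \<union> C)"
    using C(1,3) G by (intro finite_measure_mono) auto
  also have "\<dots> \<le> prob ?G + prob C" by (rule measure_Un_le[OF G C(1)])
  finally have "(1 - 2 * \<nu>) * prob E \<le> prob ?G" using C(2) by (simp add: algebra_simps)
  thus ?thesis using ne by (simp add: Max_le_iff image_iff)
qed

end

theorem lemma1:
  fixes M :: "'a measure"
    and W :: "real \<Rightarrow> real \<Rightarrow> real"
    and N :: nat
    and \<nu> :: real
    and U X :: "nat \<Rightarrow> 'a \<Rightarrow> real"
    and A Abar :: "'a \<Rightarrow> real mat"
  assumes "prob_space M"
    and "graphon W"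
    and "N \<ge> 1"
    and "0 < \<nu>" and "\<nu> < 1"
    and "iid_uniform M N U"
    and "X = latent N U"
    and "Abar = weighted_adjacency W N X"
    and "random_adjacency M W N X A"
  shows
    "\<P>(\<omega> in M.
        (MAX i\<in>{..<N}. \<bar>normalized_degree (A \<omega>) i - normalized_degree (Abar \<omega>) i\<bar>)
          \<le> sqrt (ln (2 * real N / \<nu>) / real N)) \<ge> 1 - \<nu>
     \<and>
     (\<P>(\<omega> in M. sorted_degrees (Abar \<omega>) ! (N - 1) > 4 / 9 * ln (2 * real N / \<nu>)) > 0 \<longrightarrow>
      \<P>(\<omega> in M.
        (MAX i\<in>{..<N}. \<bar>normalized_laplacian_eigenvalue (A \<omega>) i
                          - normalized_laplacian_eigenvalue (Abar \<omega>) i\<bar>)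
          \<le> 3 * sqrt (ln (2 * real N / \<nu>) / real N)
        \<bar> sorted_degrees (Abar \<omega>) ! (N - 1) > 4 / 9 * ln (2 * real N / \<nu>)) \<ge> 1 - 2 * \<nu>)"
proof -
  interpret prob_space M by fact
  interpret sampled_graph M W N X A Abar
  proof unfold_locales
    fix i assume "i < N"
    thus "X i \<in> borel_measurable M"
      unfolding assms(7) by (rule latent_measurable[OF assms(1,6)])
    fix \<omega> assume "\<omega> \<in> space M"
    with \<open>i < N\<close> show "X i \<omega> \<in> {0..1}"
      unfolding assms(7) by (rule latent_range[OF assms(6)])
  qed (fact assms)+
  let ?P = "\<lambda>\<omega>. (MAX i\<in>{..<N}. \<bar>normalized_laplacian_eigenvalue (A \<omega>) i
      - normalized_laplacian_eigenvalue (Abar \<omega>) i\<bar>) \<le> 3 * sqrt (ln (2 * real N / \<nu>) / real N)"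
  let ?Q = "\<lambda>\<omega>. sorted_degrees (Abar \<omega>) ! (N - 1) > 4 / 9 * ln (2 * real N / \<nu>)"
  \<comment> \<open>The conditioning event takes the place of \<open>E\<close>; division by its
    positive probability then gives the conditional statement.\<close>
  have "(1 - 2 * \<nu>) * \<P>(\<omega> in M. ?Q \<omega>) \<le> prob {\<omega> \<in> {\<omega> \<in> space M. ?Q \<omega>}. ?P \<omega>}"
    by (rule laplacian_event[OF assms(3-5) max_degree_event[OF assms(3)]])
  also have "{\<omega> \<in> {\<omega> \<in> space M. ?Q \<omega>}. ?P \<omega>} = {\<omega> \<in> space M. ?P \<omega> \<and> ?Q \<omega>}" by auto
  finally have "1 - 2 * \<nu> \<le> \<P>(\<omega> in M. ?P \<omega> \<bar> ?Q \<omega>)" if "\<P>(\<omega> in M. ?Q \<omega>) > 0"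
    using that unfolding cond_prob_def by (simp add: field_simps)
  thus ?thesis using degree_event[OF assms(3-5)] by blast
qed

end
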